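(* Let $H=C_1\xrightarrow{(0,1)}C_1,F_{(0,2)}$. Then $L(H)$ is Wadge complete for the class of deterministic $\Delta^0_3$ tree languages: $L(H)\in\Delta^0_3$, and for every deterministic parity tree automaton $A$ with $L(A)\in\Delta^0_3$ we have $L(A)\le_W L(H)$.
   Context: Deterministic parity tree automata: total $\delta:Q\times\Sigma\to Q\times Q$; accepted iff on every path of the run the highest rank seen infinitely often is even. $\top$: all-accepting state (even rank, $\top\xrightarrow{\sigma}\top,\top$); $\bot$: all-rejecting. Extending an automaton to a larger alphabet: new letters lead from $\bot$ to $\bot,\bot$ and from every other state to $\top,\top$. Canonical flower $F_{(\iota,\kappa)}$ ($\iota\le\kappa$): alphabet $\{a_\iota,\dots,a_\kappa\}$, states $q_\iota,\dots,q_\kappa$ (initial $q_\iota$, $\mathrm{rank}(q_i)=i$) and $\top$, transitions $q_\iota\xrightarrow{a_\iota}q_\iota,\top$; $q_\iota\xrightarrow{a_j}q_j,\top$, $q_j\xrightarrow{a_j}q_\iota,\top$ and $q_j\xrightarrow{a_k}\top,\top$ ($k\ne j$) for $\iota<j\le\kappa$. $C_1=F_{(0,0)}$. $(\iota,\kappa)$-replication $A\xrightarrow{(\iota,\kappa)}A_\iota,\dots,A_\kappa$: take a copy of $F_{(\iota,\kappa)}$ and disjoint copies of $A,A_\iota,\dots,A_\kappa$, all extended to the union of their alphabets together with $\{a_\iota,\dots,a_\kappa,b\}$ ($b$ fresh); replace $q_\iota\xrightarrow{b}\top,\top$ by $q_\iota\xrightarrow{b}q_0^A,\top$, and for each $i=\iota,\dots,\kappa$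 replace the right target $\top$ of the transition of $q_\iota$ on $a_i$ by the initial state of $A_i$. $\Delta^0_3=\Sigma^0_3\cap\Pi^0_3$ in the tree space $T_\Sigma$ with metric $d(s,t)=2^{-\min\{|x|:s(x)\ne t(x)\}}$; $\le_W$ is continuous reducibility. *)

theory Defs
  imports Complex_Main
begin

text \<open>Full binary trees over an alphabet: functions from nodes (bool lists, read from the
root; False = left child, True = right child) to letters.  The tree space T_Sigma is the
set of such functions with all labels in Sigma.\<close>

definition trees :: "'a set \<Rightarrow> (bool list \<Rightarrow> 'a) set" where
  "trees Sig = {t. \<forall>x. t x \<in> Sig}"

record ('q, 'a) dpta =
  states :: "'q set"
  alph   :: "'a set"
  init   :: 'q
  trans  :: "'q \<Rightarrow> 'a \<Rightarrow> 'q \<times> 'q"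
  rank   :: "'q \<Rightarrow> nat"

definition wf_dpta :: "('q, 'a) dpta \<Rightarrow> bool" where
  "wf_dpta A \<longleftrightarrow> finite (states A) \<and> finite (alph A) \<and> init A \<in> states A \<and>
     (\<forall>q\<in>states A. \<forall>a\<in>alph A. fst (trans A q a) \<in> states A \<and> snd (trans A q a) \<in> states A)"

fun run_from :: "('q \<Rightarrow> 'a \<Rightarrow> 'q \<times> 'q) \<Rightarrow> 'q \<Rightarrow> (bool list \<Rightarrow> 'a) \<Rightarrow> bool list \<Rightarrow> 'q" where
  "run_from \<delta> q t [] = q"
| "run_from \<delta> q t (d # x) =
     run_from \<delta> (if d then snd (\<delta> q (t [])) else fst (\<delta> q (t []))) (\<lambda>y. t (d # y)) x"

definition run :: "('q, 'a) dpta \<Rightarrow> (bool list \<Rightarrow> 'a) \<Rightarrow> bool list \<Rightarrow> 'q" where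
  "run A t = run_from (trans A) (init A) t"

definition parity_ok :: "('q \<Rightarrow> nat) \<Rightarrow> (nat \<Rightarrow> 'q) \<Rightarrow> bool" where
  "parity_ok rk s \<longleftrightarrow>
     (\<exists>k. even k \<and> infinite {n. rk (s n) = k} \<and> (\<forall>j>k. finite {n. rk (s n) = j}))"

definition lang :: "('q, 'a) dpta \<Rightarrow> (bool list \<Rightarrow> 'a) set" where
  "lang A = {t \<in> trees (alph A).
     \<forall>\<pi> :: nat \<Rightarrow> bool. parity_ok (rank A) (\<lambda>n. run A t (map \<pi> [0..<n]))}"

definition tree_dist :: "(bool list \<Rightarrow> 'a) \<Rightarrow> (bool list \<Rightarrow> 'a) \<Rightarrow> real" where
  "tree_dist s t = (if s = t then 0
      else (1/2) ^ (LEAST n. \<exists>x. length x = n \<and> s x \<noteq> t x))"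

definition tree_open :: "(bool list \<Rightarrow> 'a) set \<Rightarrow> (bool list \<Rightarrow> 'a) set \<Rightarrow> bool" where
  "tree_open T U \<longleftrightarrow> U \<subseteq> T \<and>
     (\<forall>t\<in>U. \<exists>e>0. \<forall>s\<in>T. tree_dist s t < e \<longrightarrow> s \<in> U)"

fun borel_Sigma :: "(bool list \<Rightarrow> 'a) set \<Rightarrow> nat \<Rightarrow> (bool list \<Rightarrow> 'a) set set" where
  "borel_Sigma T 0 = {}"
| "borel_Sigma T (Suc 0) = {U. tree_open T U}"
| "borel_Sigma T (Suc (Suc n)) =
     {\<Union>i. B i | B. \<forall>i::nat. B i \<in> (\<lambda>U. T - U) ` borel_Sigma T (Suc n)}"

definition borel_Pi :: "(bool list \<Rightarrow> 'a) set \<Rightarrow> nat \<Rightarrow> (bool list \<Rightarrow> 'a) set set" where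
  "borel_Pi T n = (\<lambda>U. T - U) ` borel_Sigma T n"

definition borel_Delta :: "(bool list \<Rightarrow> 'a) set \<Rightarrow> nat \<Rightarrow> (bool list \<Rightarrow> 'a) set set" where
  "borel_Delta T n = borel_Sigma T n \<inter> borel_Pi T n"

definition tree_continuous ::
  "(bool list \<Rightarrow> 'a) set \<Rightarrow> ((bool list \<Rightarrow> 'a) \<Rightarrow> (bool list \<Rightarrow> 'b)) \<Rightarrow> bool" where
  "tree_continuous T f \<longleftrightarrow>
     (\<forall>t\<in>T. \<forall>e>0. \<exists>d>0. \<forall>s\<in>T. tree_dist s t < d \<longrightarrow> tree_dist (f s) (f t) < e)"

definition wadge_le ::
  "(bool list \<Rightarrow> 'a) set \<Rightarrow> (bool list \<Rightarrow> 'a) set \<Rightarrow>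
   (bool list \<Rightarrow> 'b) set \<Rightarrow> (bool list \<Rightarrow> 'b) set \<Rightarrow> bool" where
  "wadge_le T L T' M \<longleftrightarrow> (\<exists>f. (\<forall>t\<in>T. f t \<in> T') \<and> tree_continuous T f \<and>
      (\<forall>t\<in>T. t \<in> L \<longleftrightarrow> f t \<in> M))"

text \<open>Alphabet: union of the alphabets of C_1 = F_(0,0) ({a_0}), F_(0,2) ({a_0,a_1,a_2})
and {a_0,a_1,b}: i.e. {a_0,a_1,a_2,b}.\<close>

datatype letter = a0 | a1 | a2 | b

text \<open>States: the copy of F_(0,1) (P0 initial, P1); the copy of A = C_1 (state CA);
the copy of A_0 = C_1 (state C0); the copy of A_1 = F_(0,2) (R0, R1, R2); and the
all-accepting state Top (all copies of Top are identified, which does not change the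
language).\<close>

datatype hstate = P0 | P1 | CA | C0 | R0 | R1 | R2 | Top

fun H_rank :: "hstate \<Rightarrow> nat" where
  "H_rank P0 = 0" | "H_rank P1 = 1" | "H_rank CA = 0" | "H_rank C0 = 0"
| "H_rank R0 = 0" | "H_rank R1 = 1" | "H_rank R2 = 2" | "H_rank Top = 0"

fun H_trans :: "hstate \<Rightarrow> letter \<Rightarrow> hstate \<times> hstate" where
  \<comment> \<open>flower F_(0,1), with replication modifications\<close>
  "H_trans P0 a0 = (P0, C0)"     \<comment> \<open>right target replaced by initial state of A_0\<close>
| "H_trans P0 a1 = (P1, R0)"     \<comment> \<open>right target replaced by initial state of A_1\<close>
| "H_trans P0 a2 = (Top, Top)"
| "H_trans P0 b  = (CA, Top)"    \<comment> \<open>b leads to the initial state of A\<close>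
| "H_trans P1 a1 = (P0, Top)"
| "H_trans P1 _  = (Top, Top)"
| "H_trans CA a0 = (CA, Top)"
| "H_trans CA _  = (Top, Top)"
| "H_trans C0 a0 = (C0, Top)"
| "H_trans C0 _  = (Top, Top)"
| "H_trans R0 a0 = (R0, Top)"
| "H_trans R0 a1 = (R1, Top)"
| "H_trans R0 a2 = (R2, Top)"
| "H_trans R0 b  = (Top, Top)"
| "H_trans R1 a1 = (R0, Top)"
| "H_trans R1 _  = (Top, Top)"
| "H_trans R2 a2 = (R0, Top)"
| "H_trans R2 _  = (Top, Top)"
| "H_trans Top _ = (Top, Top)"

definition H :: "(hstate, letter) dpta" where
  "H = \<lparr>states = UNIV, alph = UNIV, init = P0, trans = H_trans, rank = H_rank\<rparr>"

end

theory Submission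
  imports Defs "HOL-Library.Countable"
begin

text \<open>
Call a transition productive if both of its targets accept some tree, and call a state alive if
productive transitions lead from it to a state with an even loop and an odd loop of higher
maximal rank. If an accepting loop at a reachable state branches off to an alive state, then the
set of 0/1 matrices all of whose rows are finite reduces continuously to the language, and a
Baire-category argument shows that this set is not \<open>\<Sigma>\<^sup>0\<^sub>3\<close>. So a
\<open>\<Delta>\<^sup>0\<^sub>3\<close> automaton has no such loop. Then, on an accepted tree, the
nodes with alive state form finitely many branches (otherwise Koenig's lemma yields a path that
branches into alive states infinitely often, hence such a loop), while on paths leaving the alive
nodes the parity condition is a Buechi condition.

Hence acceptance means: one \<open>\<Pi>\<^sup>0\<^sub>2\<close> condition on the non-alive part, finitely
many alive branches, and on each of these finitely many Streett conditions ``rank \<open>2j+1\<close>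
occurs finitely often or higher ranks occur infinitely often''. The automaton \<open>H\<close> checks
exactly such combinations: its main branch may spawn finitely many tests, and each test, run by
\<open>F\<close> with index \<open>(0,2)\<close>, decides one condition of the form ``finitely many 1
or infinitely many 2''.
\<close>

subsection \<open>Parity conditions, paths and the tree topology\<close>

lemma finite_nat_iff_eventually_not: "finite {n::nat. P n} \<longleftrightarrow> (\<exists>N. \<forall>n\<ge>N. \<not> P n)"
  unfolding finite_nat_set_iff_bounded by (simp add: not_less[symmetric]) (metis not_less)

lemma infinite_nat_iff_unbounded: "infinite {n::nat. P n} \<longleftrightarrow> (\<forall>N. \<exists>n\<ge>N. P n)"
  by (simp add: finite_nat_iff_eventually_not)

lemma infinite_pigeonhole:
  assumes "infinite {n::nat. P n}" and "finite Q" and "\<And>n. P n \<Longrightarrow> s n \<in> Q"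
  obtains q where "infinite {n. P n \<and> s n = q}"
proof -
  have "{n. P n} = (\<Union>q\<in>Q. {n. P n \<and> s n = q})" using assms(3) by auto
  then show thesis using assms(1,2) that by (metis (no_types, lifting) finite_UN)
qed

text \<open>The witness in \<open>parity_ok\<close> can only be the largest rank seen infinitely
  often, so the condition reduces to the parity of that one number.\<close>

lemma parity_ok_iff_even:
  assumes "infinite {n. rk (s n) = k}" and "\<And>n. n \<ge> N \<Longrightarrow> rk (s n) \<le> k"
  shows "parity_ok rk s \<longleftrightarrow> even k"
proof -
  have fin: "finite {n. rk (s n) = j}" if "j > k" for j
    unfolding finite_nat_iff_eventually_not using assms(2) that by (intro exI[of _ N]) (meson leD)
  show ?thesis
  proof
    assume "parity_ok rk s"
    then obtain l where l: "even l" "infinite {n. rk (s n) = l}" "\<forall>j>l. finite {n. rk (s n) = j}"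
      unfolding parity_ok_def by blast
    then have "l = k" using fin assms(1) by (metis linorder_neqE_nat)
    with l show "even k" by simp
  next
    assume "even k"
    then show "parity_ok rk s" unfolding parity_ok_def using assms(1) fin by blast
  qed
qed

text \<open>The ranks seen infinitely often form a finite set, nonempty by the pigeonhole principle,
  and k is its maximum. Only finitely many larger ranks occur, each finitely often, which gives
  N.\<close>

lemma limsup_rank_exists:
  fixes rk :: "'q \<Rightarrow> nat"
  assumes "finite Q" and "\<And>n. s n \<in> Q"
  obtains k N where "infinite {n::nat. rk (s n) = k}" and "\<And>n. n \<ge> N \<Longrightarrow> rk (s n) \<le> k"
proof -
  define I where "I = {k. infinite {n. rk (s n) = k}}"
  have "I \<subseteq> rk ` Q"
  proof
    fix k assume "k \<in> I"
    then have "infinite {n. rk (s n) = k}" by (simp add: I_def)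
    then have "{n. rk (s n) = k} \<noteq> {}" by (metis finite.emptyI)
    then show "k \<in> rk ` Q" using assms(2) by auto
  qed
  then have finI: "finite I" using assms(1) finite_surj by blast
  obtain q where "infinite {n. True \<and> s n = q}"
    using infinite_pigeonhole[of "\<lambda>_. True" Q s] assms by auto
  then have "infinite {n. rk (s n) = rk q}"
    by (rule contrapos_nn) (rule finite_subset, auto)
  then have neI: "I \<noteq> {}" by (auto simp: I_def)
  define k where "k = Max I"
  have "finite (\<Union>j\<in>{j\<in>rk ` Q. j > k}. {n. rk (s n) = j})"
  proof (rule finite_UN_I)
    fix j assume "j \<in> {j\<in>rk ` Q. j > k}"
    then have "k < j" by blast
    then have "j \<notin> I" using Max_ge[OF finI, of j] unfolding k_def by linarith
    then show "finite {n. rk (s n) = j}" by (simp add: I_def)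
  qed (use assms(1) in simp)
  moreover have "(\<Union>j\<in>{j\<in>rk ` Q. j > k}. {n. rk (s n) = j}) = {n. rk (s n) > k}"
    using assms(2) by auto
  ultimately have "finite {n. rk (s n) > k}" by simp
  then obtain N where N: "\<forall>n\<ge>N. \<not> rk (s n) > k" unfolding finite_nat_iff_eventually_not by blast
  have "k \<in> I" using finI neI by (simp add: k_def)
  then have "infinite {n. rk (s n) = k}" by (simp add: I_def)
  then show thesis using N by (intro that[of k N]) (simp_all add: not_less)
qed

lemma parity_ok_shift: "parity_ok rk (\<lambda>n. s (n + k)) \<longleftrightarrow> parity_ok rk s"
proof -
  have "finite {n. P (n + k)} \<longleftrightarrow> finite {n. P n}" for P :: "nat \<Rightarrow> bool"
    using eventually_sequentially_seg[of "\<lambda>n. \<not> P n" k]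
    by (simp add: finite_nat_iff_eventually_not eventually_sequentially)
  from this[of "\<lambda>n. rk (s n) = _"] show ?thesis unfolding parity_ok_def by simp
qed

section \<open>Finite prefixes of infinite paths\<close>

definition pfx :: "(nat \<Rightarrow> bool) \<Rightarrow> nat \<Rightarrow> bool list" where
  "pfx \<pi> n = map \<pi> [0..<n]"

lemma pfx_0 [simp]: "pfx \<pi> 0 = []" by (simp add: pfx_def)
lemma pfx_Suc: "pfx \<pi> (Suc n) = pfx \<pi> n @ [\<pi> n]" by (simp add: pfx_def)
lemma length_pfx [simp]: "length (pfx \<pi> n) = n" by (simp add: pfx_def)
lemma take_pfx [simp]: "k \<le> n \<Longrightarrow> take k (pfx \<pi> n) = pfx \<pi> k"
  by (simp add: pfx_def take_map)
lemma pfx_add: "pfx \<pi> (n + k) = pfx \<pi> n @ pfx (\<lambda>i. \<pi> (n + i)) k"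
  by (induction k) (auto simp: pfx_Suc)
lemma pfx_Cons: "pfx \<pi> (Suc n) = \<pi> 0 # pfx (\<lambda>i. \<pi> (Suc i)) n"
  using pfx_add[of \<pi> 1 n] by (simp add: pfx_def)
lemma pfx_through: "\<exists>\<pi>'. \<forall>n. pfx \<pi>' (length x + n) = x @ pfx \<pi> n"
proof -
  define \<pi>' where "\<pi>' n = (if n < length x then x ! n else \<pi> (n - length x))" for n
  have "pfx \<pi>' (length x) = x" by (rule nth_equalityI) (auto simp: pfx_def \<pi>'_def)
  then have "pfx \<pi>' (length x + n) = x @ pfx \<pi> n" for n by (simp add: pfx_add \<pi>'_def)
  then show ?thesis by blast
qed

lemma pfx_False: "pfx (\<lambda>_. False) n = replicate n False"
  by (simp add: pfx_def map_replicate_const)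

text \<open>Koenig's lemma for a set of nodes that need not be closed under prefixes: the path may
  miss X, but infinitely many members of X extend each of its prefixes. Start nodes call for this
  form.\<close>

lemma konig:
  fixes X :: "bool list set"
  assumes "infinite X"
  obtains \<pi> where "\<And>n. infinite {z \<in> X. take n z = pfx \<pi> n}"
proof -
  define P where "P x \<longleftrightarrow> infinite {z \<in> X. take (length x) z = x}" for x
  have step: "\<exists>d. P (x @ [d])" if "P x" for x
  proof (rule ccontr)
    assume "\<nexists>d. P (x @ [d])"
    \<comment> \<open>A member of X extending x is x itself or extends one of the two children; all
      three classes would be finite.\<close>
    then have "finite ({x} \<union> {z \<in> X. take (length (x @ [True])) z = x @ [True]}
       \<union> {z \<in> X. take (length (x @ [False])) z = x @ [False]})" unfolding P_def by blast
    moreover have "{z \<in> X. take (length x) z = x} \<subseteq> {x} \<union> {z \<in> X. take (length (x @ [True])) z = x @ [True]}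
       \<union> {z \<in> X. take (length (x @ [False])) z = x @ [False]}"
    proof
      fix z assume z: "z \<in> {z \<in> X. take (length x) z = x}"
      show "z \<in> {x} \<union> {z \<in> X. take (length (x @ [True])) z = x @ [True]}
         \<union> {z \<in> X. take (length (x @ [False])) z = x @ [False]}"
      proof (cases "length z = length x")
        case True then show ?thesis using z by auto
      next
        case False
        with z have "length x < length z" by (metis (mono_tags, lifting) length_take mem_Collect_eq min_def not_le_imp_less le_neq_implies_less)
        then have "take (Suc (length x)) z = x @ [z ! length x]"
          using z by (simp add: take_Suc_conv_app_nth)
        then show ?thesis using z by (cases "z ! length x") auto
      qed
    qed
    ultimately show False using that finite_subset unfolding P_def by blast
  qed
  define f where "f = rec_nat [] (\<lambda>_ x. x @ [SOME d. P (x @ [d])])"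
  define \<pi> where "\<pi> n = (SOME d. P (f n @ [d]))" for n
  have f: "f n = pfx \<pi> n" for n
    by (induction n) (simp_all add: f_def pfx_Suc \<pi>_def)
  have "P (f n)" for n
  proof (induction n)
    case 0 then show ?case using assms by (simp add: f_def P_def)
  next
    case (Suc n)
    then have "P (f n @ [\<pi> n])" unfolding \<pi>_def by (rule someI_ex[OF step])
    then show ?case by (simp add: f pfx_Suc)
  qed
  then have "infinite {z \<in> X. take n z = pfx \<pi> n}" for n by (simp add: P_def f)
  then show thesis by (rule that)
qed

section \<open>Runs and acceptance on subtrees\<close>

definition child :: "bool \<Rightarrow> 'q \<times> 'q \<Rightarrow> 'q" where
  "child d p = (if d then snd p else fst p)"

definition subtree :: "(bool list \<Rightarrow> 'a) \<Rightarrow> bool list \<Rightarrow> bool list \<Rightarrow> 'a" where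
  "subtree t x = (\<lambda>y. t (x @ y))"

lemma subtree_Nil [simp]: "subtree t [] = t" by (simp add: subtree_def)
lemma subtree_trees: "t \<in> trees S \<Longrightarrow> subtree t x \<in> trees S" by (simp add: subtree_def trees_def)

definition accepts :: "('q, 'a) dpta \<Rightarrow> 'q \<Rightarrow> (bool list \<Rightarrow> 'a) \<Rightarrow> bool" where
  "accepts A q t \<longleftrightarrow> (\<forall>\<pi>. parity_ok (rank A) (\<lambda>n. run_from (trans A) q t (pfx \<pi> n)))"

lemma lang_accepts: "lang A = {t \<in> trees (alph A). accepts A (init A) t}"
  by (simp add: lang_def accepts_def run_def pfx_def)

lemma run_from_append:
  "run_from \<delta> q t (x @ y) = run_from \<delta> (run_from \<delta> q t x) (subtree t x) y"
  by (induction x arbitrary: q t) (auto simp: subtree_def)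

lemma run_from_snoc:
  "run_from \<delta> q t (x @ [d]) = child d (\<delta> (run_from \<delta> q t x) (t x))"
  by (simp add: run_from_append child_def subtree_def)

lemma accepts_run_from:
  assumes "accepts A q t"
  shows "accepts A (run_from (trans A) q t x) (subtree t x)"
  unfolding accepts_def
proof
  fix \<pi>
  obtain \<pi>' where "\<And>n. pfx \<pi>' (length x + n) = x @ pfx \<pi> n" using pfx_through by blast
  then have "pfx \<pi>' (n + length x) = x @ pfx \<pi> n" for n by (simp add: add.commute)
  moreover have "parity_ok (rank A) (\<lambda>n. run_from (trans A) q t (pfx \<pi>' (n + length x)))"
    using assms unfolding accepts_def parity_ok_shift[of "rank A" "\<lambda>n. run_from (trans A) q t (pfx \<pi>' n)"] by simp
  ultimately show "parity_ok (rank A) (\<lambda>n. run_from (trans A) (run_from (trans A) q t x) (subtree t x) (pfx \<pi> n))"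
    by (simp add: run_from_append)
qed

text \<open>A path other than d leaves d at a first index n and from then on is a path of the
  sibling subtree; the finite common part does not influence parity.\<close>

lemma accepts_spine:
  fixes A q t d
  defines "Q \<equiv> \<lambda>n. run_from (trans A) q t (pfx d n)"
  shows "accepts A q t \<longleftrightarrow> parity_ok (rank A) Q \<and>
     (\<forall>n. accepts A (child (\<not> d n) (trans A (Q n) (t (pfx d n)))) (subtree t (pfx d n @ [\<not> d n])))"
    (is "_ \<longleftrightarrow> _ \<and> ?sib")
proof
  assume acc: "accepts A q t"
  then have "parity_ok (rank A) Q" unfolding accepts_def Q_def by simp
  moreover have ?sib using accepts_run_from[OF acc, of "pfx d _ @ [\<not> d _]"]
    by (simp add: run_from_snoc Q_def)
  ultimately show "parity_ok (rank A) Q \<and> ?sib" ..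
next
  assume R: "parity_ok (rank A) Q \<and> ?sib"
  show "accepts A q t"
    unfolding accepts_def
  proof
    fix \<pi>
    show "parity_ok (rank A) (\<lambda>n. run_from (trans A) q t (pfx \<pi> n))"
    proof (cases "\<pi> = d")
      case True then show ?thesis using R by (simp add: Q_def)
    next
      case False
      define n where "n = (LEAST n. \<pi> n \<noteq> d n)"
      have n: "\<pi> n \<noteq> d n" "\<And>i. i < n \<Longrightarrow> \<pi> i = d i"
        using False LeastI_ex[of "\<lambda>n. \<pi> n \<noteq> d n"] not_less_Least unfolding n_def by blast+
      then have "pfx \<pi> n = pfx d n" by (simp add: pfx_def)
      then have p: "pfx \<pi> (Suc n) = pfx d n @ [\<not> d n]" using n by (simp add: pfx_Suc)
      have eq: "run_from (trans A) q t (pfx \<pi> (m + Suc n)) =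
         run_from (trans A) (child (\<not> d n) (trans A (Q n) (t (pfx d n)))) (subtree t (pfx d n @ [\<not> d n]))
           (pfx (\<lambda>i. \<pi> (Suc n + i)) m)" for m
        by (subst add.commute, subst pfx_add, simp add: p run_from_append Q_def child_def subtree_def)
      from R have "parity_ok (rank A) (\<lambda>m. run_from (trans A) q t (pfx \<pi> (m + Suc n)))"
        unfolding eq accepts_def by blast
      then show ?thesis using parity_ok_shift[of "rank A" "\<lambda>n. run_from (trans A) q t (pfx \<pi> n)" "Suc n"] by simp
    qed
  qed
qed

section \<open>The tree metric expressed by agreement up to a depth\<close>

definition agree :: "nat \<Rightarrow> (bool list \<Rightarrow> 'a) \<Rightarrow> (bool list \<Rightarrow> 'a) \<Rightarrow> bool" where
  "agree n s t \<longleftrightarrow> (\<forall>x. length x \<le> n \<longrightarrow> s x = t x)"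

text \<open>The first level of disagreement must exceed n, which is why the strict inequality
  matches agreement up to and including depth n. All topology below is done with
  \<open>agree\<close>.\<close>

lemma tree_dist_less_iff: "tree_dist s t < (1/2) ^ n \<longleftrightarrow> agree n s t"
proof (cases "s = t")
  case False
  define m where "m = (LEAST n. \<exists>x. length x = n \<and> s x \<noteq> t x)"
  from False obtain x where "s x \<noteq> t x" by blast
  then have ex: "\<exists>n x. length x = n \<and> s x \<noteq> t x" by blast
  have m: "\<exists>x. length x = m \<and> s x \<noteq> t x" unfolding m_def by (rule LeastI_ex[OF ex])
  have l: "\<And>x. s x \<noteq> t x \<Longrightarrow> m \<le> length x" unfolding m_def by (rule Least_le) blast
  have "tree_dist s t < (1/2) ^ n \<longleftrightarrow> n < m"
    using False by (simp add: tree_dist_def m_def[symmetric] power_strict_decreasing_iff)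
  also have "\<dots> \<longleftrightarrow> agree n s t" unfolding agree_def using m l by (meson leD le_trans not_le)
  finally show ?thesis .
qed (simp add: tree_dist_def agree_def)

lemma half_power_below: "e > 0 \<Longrightarrow> \<exists>n. (1/2::real) ^ n < e"
  using real_arch_pow_inv[of e "1/2"] by simp

lemma tree_open_iff:
  "tree_open T U \<longleftrightarrow> U \<subseteq> T \<and> (\<forall>t\<in>U. \<exists>n. \<forall>s\<in>T. agree n s t \<longrightarrow> s \<in> U)"
proof -
  have "(\<exists>e>0. \<forall>s\<in>T. tree_dist s t < e \<longrightarrow> s \<in> U) \<longleftrightarrow> (\<exists>n. \<forall>s\<in>T. agree n s t \<longrightarrow> s \<in> U)" for t
  proof
    assume "\<exists>e>0. \<forall>s\<in>T. tree_dist s t < e \<longrightarrow> s \<in> U"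
    then obtain e where "e > 0" and e: "\<forall>s\<in>T. tree_dist s t < e \<longrightarrow> s \<in> U" by blast
    then obtain n where "(1/2::real) ^ n < e" using half_power_below by blast
    then have "\<forall>s\<in>T. agree n s t \<longrightarrow> s \<in> U"
      using e unfolding tree_dist_less_iff[symmetric] by (metis order_less_trans)
    then show "\<exists>n. \<forall>s\<in>T. agree n s t \<longrightarrow> s \<in> U" ..
  next
    assume "\<exists>n. \<forall>s\<in>T. agree n s t \<longrightarrow> s \<in> U"
    then obtain n where "\<forall>s\<in>T. tree_dist s t < (1/2) ^ n \<longrightarrow> s \<in> U"
      unfolding tree_dist_less_iff by blast
    then show "\<exists>e>0. \<forall>s\<in>T. tree_dist s t < e \<longrightarrow> s \<in> U"
      by (intro exI[of _ "(1/2) ^ n"]) simp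
  qed
  then show ?thesis by (simp add: tree_open_def)
qed

text \<open>Only finitely many output nodes lie within depth N, so the maximum of their moduli
  serves all of them at once.\<close>

lemma tree_continuousI:
  assumes "\<And>y. \<exists>n. \<forall>s\<in>T. \<forall>t\<in>T. agree n s t \<longrightarrow> f s y = f t y"
  shows "tree_continuous T f"
  unfolding tree_continuous_def
proof (intro ballI allI impI)
  fix t and e :: real assume t: "t \<in> T" and "e > 0"
  then obtain N where N: "(1/2::real) ^ N < e" using half_power_below by blast
  obtain g where g: "\<And>y. \<forall>s\<in>T. \<forall>t\<in>T. agree (g y) s t \<longrightarrow> f s y = f t y" using assms by metis
  have fin: "finite {y::bool list. length y \<le> N}" using finite_lists_length_le[of "UNIV :: bool set" N] by simp
  define M where "M = Max (g ` {y. length y \<le> N})"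
  have "tree_dist (f s) (f t) < e" if s: "s \<in> T" "agree M s t" for s
  proof -
    have "f s y = f t y" if "length y \<le> N" for y
    proof -
      have "g y \<le> M" unfolding M_def using fin that by (intro Max_ge) auto
      then have "agree (g y) s t" using s(2) by (auto simp: agree_def)
      then show ?thesis using g s t by blast
    qed
    then have "agree N (f s) (f t)" by (simp add: agree_def)
    then show ?thesis using N unfolding tree_dist_less_iff[symmetric] by linarith
  qed
  then show "\<exists>d>0. \<forall>s\<in>T. tree_dist s t < d \<longrightarrow> tree_dist (f s) (f t) < e"
    by (intro exI[of _ "(1/2) ^ M"]) (simp add: tree_dist_less_iff)
qed

text \<open>The state at depth n + 1 is determined by labels of depth at most n, hence the bound
  \<open>Suc n\<close>.\<close>

lemma run_from_agree: "agree n s t \<Longrightarrow> length x \<le> Suc n \<Longrightarrow> run_from \<delta> q s x = run_from \<delta> q t x"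
proof (induction x rule: rev_induct)
  case (snoc d x)
  then show ?case by (simp add: run_from_snoc agree_def)
qed simp

text \<open>Resolving the two nested complements by De Morgan turns level 3 into countable unions of
  \<open>G\<^sub>\<delta>\<close> sets.\<close>

lemma borel_Sigma_3:
  "borel_Sigma T 3 = {\<Union>i. T \<inter> (\<Inter>j. V i j) | V :: nat \<Rightarrow> nat \<Rightarrow> _. \<forall>i j. tree_open T (V i j)}"
proof -
  have 2: "(X \<in> (\<lambda>U. T - U) ` borel_Sigma T (Suc (Suc 0))) \<longleftrightarrow>
      (\<exists>V :: nat \<Rightarrow> _. (\<forall>j. tree_open T (V j)) \<and> X = T \<inter> (\<Inter>j. V j))" for X
  proof
    assume "X \<in> (\<lambda>U. T - U) ` borel_Sigma T (Suc (Suc 0))"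
    then obtain B :: "nat \<Rightarrow> _" where B: "\<forall>i. B i \<in> (\<lambda>U. T - U) ` {U. tree_open T U}"
      and X: "X = T - (\<Union>i. B i)" by auto
    from B have "\<forall>i. \<exists>U. tree_open T U \<and> B i = T - U" by blast
    then obtain V where V: "\<forall>i. tree_open T (V i) \<and> B i = T - V i" by metis
    then have "X = T \<inter> (\<Inter>j. V j)" using X by auto
    then show "\<exists>V :: nat \<Rightarrow> _. (\<forall>j. tree_open T (V j)) \<and> X = T \<inter> (\<Inter>j. V j)" using V by (intro exI[of _ V]) simp
  next
    assume "\<exists>V :: nat \<Rightarrow> _. (\<forall>j. tree_open T (V j)) \<and> X = T \<inter> (\<Inter>j. V j)"
    then obtain V :: "nat \<Rightarrow> _" where V: "\<forall>j. tree_open T (V j)" "X = T \<inter> (\<Inter>j. V j)" by blast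
    have "X = T - (\<Union>j. T - V j)" using V(2) by auto
    moreover have "(\<Union>j. T - V j) \<in> borel_Sigma T (Suc (Suc 0))"
      unfolding borel_Sigma.simps by (intro CollectI exI[of _ "\<lambda>j. T - V j"]) (use V(1) in simp)
    ultimately show "X \<in> (\<lambda>U. T - U) ` borel_Sigma T (Suc (Suc 0))" by blast
  qed
  have "borel_Sigma T 3 = {\<Union>i. B i | B. \<forall>i::nat. B i \<in> (\<lambda>U. T - U) ` borel_Sigma T (Suc (Suc 0))}"
    by (simp only: numeral_3_eq_3 borel_Sigma.simps(3))
  also have "\<dots> = {\<Union>i. T \<inter> (\<Inter>j. V i j) | V :: nat \<Rightarrow> nat \<Rightarrow> _. \<forall>i j. tree_open T (V i j)}"
  proof (intro set_eqI iffI)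
    fix X assume "X \<in> {\<Union>i. B i | B. \<forall>i::nat. B i \<in> (\<lambda>U. T - U) ` borel_Sigma T (Suc (Suc 0))}"
    then obtain B :: "nat \<Rightarrow> _" where X: "X = (\<Union>i. B i)"
      and "\<forall>i. B i \<in> (\<lambda>U. T - U) ` borel_Sigma T (Suc (Suc 0))" by blast
    then have B: "\<forall>i. \<exists>V :: nat \<Rightarrow> _. (\<forall>j. tree_open T (V j)) \<and> B i = T \<inter> (\<Inter>j. V j)"
      unfolding 2 by simp
    from B obtain V :: "nat \<Rightarrow> nat \<Rightarrow> _" where "\<forall>i. (\<forall>j. tree_open T (V i j)) \<and> B i = T \<inter> (\<Inter>j. V i j)"
      by metis
    then show "X \<in> {\<Union>i. T \<inter> (\<Inter>j. V i j) | V :: nat \<Rightarrow> nat \<Rightarrow> _. \<forall>i j. tree_open T (V i j)}"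
      using X by auto
  next
    fix X assume "X \<in> {\<Union>i. T \<inter> (\<Inter>j. V i j) | V :: nat \<Rightarrow> nat \<Rightarrow> _. \<forall>i j. tree_open T (V i j)}"
    then obtain V :: "nat \<Rightarrow> nat \<Rightarrow> _" where V: "\<forall>i j. tree_open T (V i j)"
      and X: "X = (\<Union>i. T \<inter> (\<Inter>j. V i j))" by blast
    have "\<forall>i. T \<inter> (\<Inter>j. V i j) \<in> (\<lambda>U. T - U) ` borel_Sigma T (Suc (Suc 0))"
    proof
      fix i
      show "T \<inter> (\<Inter>j. V i j) \<in> (\<lambda>U. T - U) ` borel_Sigma T (Suc (Suc 0))"
        unfolding 2 using V by (intro exI[of _ "V i"]) simp
    qed
    then show "X \<in> {\<Union>i. B i | B. \<forall>i::nat. B i \<in> (\<lambda>U. T - U) ` borel_Sigma T (Suc (Suc 0))}"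
      unfolding X by (intro CollectI exI[of _ "\<lambda>i. T \<inter> (\<Inter>j. V i j)"]) simp
  qed
  finally show ?thesis .
qed

subsection \<open>A set of matrices that is not \<open>\<Sigma>\<^sup>0\<^sub>3\<close>\<close>

text \<open>The upper left squares give a neighbourhood base of the product topology on 0/1
  matrices, so \<open>square_open\<close> is openness in that topology.\<close>

definition square_agree :: "nat \<Rightarrow> (nat \<Rightarrow> nat \<Rightarrow> bool) \<Rightarrow> (nat \<Rightarrow> nat \<Rightarrow> bool) \<Rightarrow> bool" where
  "square_agree N \<alpha> \<beta> \<longleftrightarrow> (\<forall>r<N. \<forall>c<N. \<alpha> r c = \<beta> r c)"

definition square_open :: "(nat \<Rightarrow> nat \<Rightarrow> bool) set \<Rightarrow> bool" where
  "square_open V \<longleftrightarrow> (\<forall>\<alpha>\<in>V. \<exists>N. \<forall>\<beta>. square_agree N \<alpha> \<beta> \<longrightarrow> \<beta> \<in> V)"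

lemma square_agree_mono: "square_agree N \<alpha> \<beta> \<Longrightarrow> M \<le> N \<Longrightarrow> square_agree M \<alpha> \<beta>"
  by (auto simp: square_agree_def)

lemma square_agree_chain:
  assumes "\<And>j. square_agree (N j) (\<alpha> j) (\<alpha> (Suc j))" "\<And>j. N j \<le> N (Suc j)" "j \<le> k"
  shows "N j \<le> N k \<and> square_agree (N j) (\<alpha> j) (\<alpha> k)"
  using assms(3)
proof (induction k rule: dec_induct)
  case (step k)
  then have "square_agree (N j) (\<alpha> k) (\<alpha> (Suc k))" using assms(1)[of k] square_agree_mono by blast
  then show ?case using step assms(2)[of k] by (auto simp: square_agree_def)
qed (simp add: square_agree_def)

text \<open>The squares grow, so \<open>k \<le> N k\<close>, and entry (r, c) is final from stage
  \<open>Suc (max r c)\<close> on. The limit can therefore be read off at that stage.\<close>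

lemma square_limit:
  assumes "\<And>j. square_agree (N j) (\<alpha> j) (\<alpha> (Suc j))" "\<And>j. N j < N (Suc j)"
  shows "square_agree (N j) (\<alpha> j) (\<lambda>r c. \<alpha> (Suc (max r c)) r c)"
proof -
  have N: "k \<le> N k" for k
    by (induction k) (use assms(2) in \<open>auto simp: Suc_le_eq intro: le_less_trans\<close>)
  have ch: "i \<le> k \<Longrightarrow> square_agree (N i) (\<alpha> i) (\<alpha> k)" for i k
    using square_agree_chain[of N \<alpha> i k] assms by (simp add: less_imp_le)
  show ?thesis
    unfolding square_agree_def
  proof (intro allI impI)
    fix r c assume rc: "r < N j" "c < N j"
    show "\<alpha> j r c = \<alpha> (Suc (max r c)) r c"
    proof (cases "j \<le> Suc (max r c)")
      case True then show ?thesis using ch rc by (auto simp: square_agree_def)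
    next
      case False
      then have "square_agree (N (Suc (max r c))) (\<alpha> (Suc (max r c))) (\<alpha> j)" using ch by simp
      moreover have "r < N (Suc (max r c))" "c < N (Suc (max r c))"
        using N[of "Suc (max r c)"] by auto
      ultimately show ?thesis by (auto simp: square_agree_def)
    qed
  qed
qed

text \<open>A standard complete set for the class \<open>\<Pi>\<^sup>0\<^sub>3\<close>.\<close>

definition finite_rows :: "(nat \<Rightarrow> nat \<Rightarrow> bool) set" where
  "finite_rows = {\<alpha>. \<forall>r. finite {c. \<alpha> r c}}"

text \<open>A condition fixes finitely many rows completely and a finite square of the remaining entries.
If every condition with finite row \<open>i\<close> met the given \<open>G\<^sub>\<delta>\<close> set,
one could alternate between entering the next open set and adding a 1 to row \<open>i\<close>,
obtaining a member of the set with an infinite row.\<close>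

lemma escape_G_delta:
  assumes V: "\<And>j. square_open (V j)" and sub: "(\<Inter>j::nat. V j) \<subseteq> finite_rows"
    and \<alpha>: "\<alpha> \<in> finite_rows"
  shows "\<exists>\<alpha>'\<in>finite_rows. \<exists>N'>N. square_agree N \<alpha> \<alpha>' \<and> (\<forall>r<i. \<alpha>' r = \<alpha> r) \<and>
     (\<forall>\<beta>. square_agree N' \<alpha>' \<beta> \<longrightarrow> (\<forall>r\<le>i. \<beta> r = \<alpha>' r) \<longrightarrow> \<beta> \<notin> (\<Inter>j. V j))"
proof (rule ccontr)
  assume "\<not> ?thesis"
  then have H: "\<exists>\<beta>\<in>(\<Inter>j. V j). square_agree N' \<alpha>' \<beta> \<and> (\<forall>r\<le>i. \<beta> r = \<alpha>' r)"
    if "\<alpha>' \<in> finite_rows" "N' > N" "square_agree N \<alpha> \<alpha>'" "\<forall>r<i. \<alpha>' r = \<alpha> r" for \<alpha>' N'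
    using that by blast
  define P where "P p \<longleftrightarrow> fst p \<in> finite_rows \<and> snd p > N \<and> square_agree N \<alpha> (fst p) \<and> (\<forall>r<i. fst p r = \<alpha> r)"
    for p :: "(nat \<Rightarrow> nat \<Rightarrow> bool) \<times> nat"
  define R where "R j p p' \<longleftrightarrow> snd p < snd p' \<and> square_agree (snd p) (fst p) (fst p') \<and>
     (\<exists>c\<ge>snd p. c < snd p' \<and> i < snd p' \<and> fst p' i c) \<and>
     (\<forall>\<gamma>. square_agree (snd p') (fst p') \<gamma> \<longrightarrow> \<gamma> \<in> V j)" for j p p'
  have "\<exists>f. \<forall>n. P (f n) \<and> R n (f n) (f (Suc n))"
  proof (rule dependent_nat_choice)
    show "\<exists>p. P p" using \<alpha> by (intro exI[of _ "(\<alpha>, Suc N)"]) (simp add: P_def square_agree_def)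
  next
    fix p j assume Pp: "P p"
    obtain \<alpha>1 N1 where p: "p = (\<alpha>1, N1)" by fastforce
    from H[of \<alpha>1 N1] Pp obtain \<beta> where \<beta>: "\<beta> \<in> (\<Inter>j. V j)" "square_agree N1 \<alpha>1 \<beta>" "\<forall>r\<le>i. \<beta> r = \<alpha>1 r"
      by (auto simp: P_def p)
    then obtain M where M: "\<And>\<gamma>. square_agree M \<beta> \<gamma> \<Longrightarrow> \<gamma> \<in> V j"
      using V[of j] unfolding square_open_def by blast
    \<comment> \<open>Column c lies outside both squares, so a new 1 at (i, c) disturbs neither the
      agreement with \<alpha>1 nor the membership in \<open>V j\<close> that \<beta>
      guarantees.\<close>
    define c where "c = max N1 M"
    define \<alpha>2 where "\<alpha>2 = (\<lambda>r k. \<beta> r k \<or> (r = i \<and> k = c))"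
    define N2 where "N2 = Suc (max c i)"
    have a: "square_agree c \<beta> \<alpha>2" by (auto simp: square_agree_def \<alpha>2_def)
    have "\<alpha>2 \<in> finite_rows"
    proof -
      have "\<beta> \<in> finite_rows" using \<beta>(1) sub by blast
      then have "finite (insert c {k. \<beta> r k})" for r by (simp add: finite_rows_def)
      then have "finite {k. \<alpha>2 r k}" for r
        by (rule rev_finite_subset) (auto simp: \<alpha>2_def)
      then show ?thesis by (simp add: finite_rows_def)
    qed
    moreover have s: "square_agree N1 \<alpha>1 \<alpha>2" using a \<beta>(2) by (auto simp: square_agree_def c_def)
    moreover have "square_agree N \<alpha> \<alpha>2" "N < N2" using s Pp
      by (auto simp: square_agree_def P_def p N2_def c_def)
    moreover have "\<forall>r<i. \<alpha>2 r = \<alpha> r" using \<beta>(3) Pp by (auto simp: \<alpha>2_def P_def p)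
    ultimately have "P (\<alpha>2, N2)" by (simp add: P_def)
    moreover have "R j p (\<alpha>2, N2)"
    proof -
      have "\<gamma> \<in> V j" if "square_agree N2 \<alpha>2 \<gamma>" for \<gamma>
        using that a by (intro M) (auto simp: square_agree_def c_def N2_def)
      moreover have "N1 \<le> c" "c < N2" "i < N2" "\<alpha>2 i c" by (auto simp: c_def N2_def \<alpha>2_def)
      ultimately show ?thesis using s unfolding R_def p by auto
    qed
    ultimately show "\<exists>p'. P p' \<and> R j p p'" by blast
  qed
  then obtain f where f: "\<And>n. P (f n)" "\<And>n. R n (f n) (f (Suc n))" by blast
  define \<gamma> where "\<gamma> = (\<lambda>r c. fst (f (Suc (max r c))) r c)"
  have inc: "snd (f n) < snd (f (Suc n))" for n using f(2)[of n] by (simp add: R_def)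
  have lim: "square_agree (snd (f n)) (fst (f n)) \<gamma>" for n
    unfolding \<gamma>_def by (rule square_limit) (use f(2) in \<open>auto simp: R_def\<close>)
  have "\<gamma> \<in> (\<Inter>j. V j)" using f(2) lim unfolding R_def by blast
  then have "finite {c. \<gamma> i c}" using sub by (auto simp: finite_rows_def)
  then obtain B where B: "\<And>c. c \<ge> B \<Longrightarrow> \<not> \<gamma> i c" unfolding finite_nat_iff_eventually_not by blast
  have ge: "n \<le> snd (f n)" for n
    by (induction n) (use inc in \<open>auto simp: Suc_le_eq intro: le_less_trans\<close>)
  obtain c where c: "c \<ge> snd (f B)" "c < snd (f (Suc B))" "i < snd (f (Suc B))" "fst (f (Suc B)) i c"
    using f(2)[of B] unfolding R_def by blast
  then have "\<gamma> i c" using lim[of "Suc B"] by (auto simp: square_agree_def)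
  then show False using B[of c] c(1) ge[of B] by simp
qed

text \<open>Stage i uses \<open>escape_G_delta\<close> to leave the i-th
  \<open>G\<^sub>\<delta>\<close> set while keeping the rows below i. Row r is then final from stage
  r + 1 on, so the limit has finite rows and yet avoids every one of the sets.\<close>

lemma finite_rows_not_Sigma3:
  assumes V: "\<And>i j. square_open (V i j)"
  shows "finite_rows \<noteq> (\<Union>i::nat. \<Inter>j::nat. V i j)"
proof
  assume eq: "finite_rows = (\<Union>i. \<Inter>j. V i j)"
  define R where "R i p p' \<longleftrightarrow> snd p < snd p' \<and> square_agree (snd p) (fst p) (fst p') \<and>
     (\<forall>r<i. fst p' r = fst p r) \<and>
     (\<forall>\<beta>. square_agree (snd p') (fst p') \<beta> \<longrightarrow> (\<forall>r\<le>i. \<beta> r = fst p' r) \<longrightarrow> \<beta> \<notin> (\<Inter>j. V i j))"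
    for i and p p' :: "(nat \<Rightarrow> nat \<Rightarrow> bool) \<times> nat"
  have "\<exists>f. \<forall>n. fst (f n) \<in> finite_rows \<and> R n (f n) (f (Suc n))"
  proof (rule dependent_nat_choice)
    show "\<exists>p :: (nat \<Rightarrow> nat \<Rightarrow> bool) \<times> nat. fst p \<in> finite_rows" by (intro exI[of _ "(\<lambda>_ _. False, 0 :: nat)"]) (simp add: finite_rows_def)
  next
    fix p i assume p: "fst (p :: (nat \<Rightarrow> nat \<Rightarrow> bool) \<times> nat) \<in> finite_rows"
    have sub: "(\<Inter>j. V i j) \<subseteq> finite_rows" using eq by blast
    obtain \<alpha>' N' where "\<alpha>' \<in> finite_rows" "R i p (\<alpha>', N')"
      using escape_G_delta[OF V sub p, of "snd p" i] unfolding R_def by auto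
    then show "\<exists>p'. fst p' \<in> finite_rows \<and> R i p p'" by (intro exI[of _ "(\<alpha>', N')"]) simp
  qed
  then obtain f where f: "\<And>n. fst (f n) \<in> finite_rows" "\<And>n. R n (f n) (f (Suc n))" by blast
  have rows: "r < i \<Longrightarrow> fst (f i) r = fst (f (Suc r)) r" for i r
  proof (induction i)
    case (Suc i)
    then show ?case using f(2)[of i] by (cases "r = i") (auto simp: R_def)
  qed simp
  define \<gamma> where "\<gamma> = (\<lambda>r c. fst (f (Suc (max r c))) r c)"
  have lim: "square_agree (snd (f n)) (fst (f n)) \<gamma>" for n
    unfolding \<gamma>_def by (rule square_limit) (use f(2) in \<open>auto simp: R_def\<close>)
  have \<gamma>: "\<gamma> r = fst (f (Suc r)) r" for r
  proof
    fix c
    show "\<gamma> r c = fst (f (Suc r)) r c"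
      unfolding \<gamma>_def by (rule fun_cong[OF rows]) (simp add: less_Suc_eq_le)
  qed
  have "\<gamma> \<in> finite_rows" using f(1) \<gamma> by (simp add: finite_rows_def)
  then obtain i where i: "\<gamma> \<in> (\<Inter>j. V i j)" using eq by blast
  have "\<forall>r\<le>i. \<gamma> r = fst (f (Suc i)) r" using rows[of _ "Suc i"] \<gamma> by (simp add: less_Suc_eq_le)
  then show False using f(2)[of i] lim[of "Suc i"] i unfolding R_def by blast
qed

subsection \<open>Replicated flowers\<close>

lemma accepts_children:
  "accepts A q t \<longleftrightarrow> (\<forall>d. accepts A (child d (trans A q (t []))) (subtree t [d]))"
proof
  assume "accepts A q t"
  from accepts_run_from[OF this, of "[_]"]
  show "\<forall>d. accepts A (child d (trans A q (t []))) (subtree t [d])" by (simp add: child_def)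
next
  assume R: "\<forall>d. accepts A (child d (trans A q (t []))) (subtree t [d])"
  show "accepts A q t" unfolding accepts_def
  proof
    fix \<pi>
    have "parity_ok (rank A) (\<lambda>n. run_from (trans A) q t (pfx \<pi> (n + 1)))"
      using R[rule_format, of "\<pi> 0"] by (simp add: accepts_def pfx_Cons child_def subtree_def)
    then show "parity_ok (rank A) (\<lambda>n. run_from (trans A) q t (pfx \<pi> n))"
      by (rule parity_ok_shift[THEN iffD1])
  qed
qed

section \<open>Loops and flowers in the productive part of an automaton\<close>

definition productive :: "('q, 'a) dpta \<Rightarrow> 'q \<Rightarrow> bool" where
  "productive A q \<longleftrightarrow> (\<exists>t\<in>trees (alph A). accepts A q t)"

text \<open>Both targets must be productive, so that whichever child a path takes, the other one can
  be filled with an accepted tree.\<close>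

definition edge :: "('q, 'a) dpta \<Rightarrow> 'q \<Rightarrow> 'a \<Rightarrow> bool \<Rightarrow> 'q \<Rightarrow> bool" where
  "edge A q a d q' \<longleftrightarrow> a \<in> alph A \<and> (\<forall>e. productive A (child e (trans A q a))) \<and> q' = child d (trans A q a)"

definition reach :: "('q, 'a) dpta \<Rightarrow> 'q \<Rightarrow> 'q \<Rightarrow> bool" where
  "reach A = (\<lambda>q q'. \<exists>a d. edge A q a d q')\<^sup>*\<^sup>*"

definition is_loop :: "('q, 'a) dpta \<Rightarrow> 'q \<Rightarrow> nat \<Rightarrow> nat \<Rightarrow> (nat \<Rightarrow> 'q) \<Rightarrow> (nat \<Rightarrow> 'a) \<Rightarrow> (nat \<Rightarrow> bool) \<Rightarrow> bool" where
  "is_loop A p K m qs ls ds \<longleftrightarrow> K > 0 \<and> qs 0 = p \<and> qs K = p \<and>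
     (\<forall>i<K. edge A (qs i) (ls i) (ds i) (qs (Suc i))) \<and>
     (\<exists>i<K. rank A (qs i) = m) \<and> (\<forall>i<K. rank A (qs i) \<le> m)"

definition has_loop :: "('q, 'a) dpta \<Rightarrow> 'q \<Rightarrow> nat \<Rightarrow> bool" where
  "has_loop A p m \<longleftrightarrow> (\<exists>K qs ls ds. is_loop A p K m qs ls ds)"

text \<open>This is the pattern of \<open>F_(0,1)\<close> up to a change of ranks: an even loop
  dominated by an odd one at the same state.\<close>

definition flower :: "('q, 'a) dpta \<Rightarrow> 'q \<Rightarrow> bool" where
  "flower A p \<longleftrightarrow> (\<exists>k m. even k \<and> odd m \<and> k < m \<and> has_loop A p k \<and> has_loop A p m)"

definition alive :: "('q, 'a) dpta \<Rightarrow> 'q \<Rightarrow> bool" where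
  "alive A q \<longleftrightarrow> (\<exists>p. reach A q p \<and> flower A p)"

text \<open>The branching is placed at the base p of the loop, which a rotation of the loop always
  achieves.\<close>

definition replicated_flower :: "('q, 'a) dpta \<Rightarrow> bool" where
  "replicated_flower A \<longleftrightarrow> (\<exists>p K m qs ls ds. reach A (init A) p \<and> is_loop A p K m qs ls ds \<and> even m \<and>
     alive A (child (\<not> ds 0) (trans A p (ls 0))))"

definition witness :: "('q, 'a) dpta \<Rightarrow> 'q \<Rightarrow> bool list \<Rightarrow> 'a" where
  "witness A q = (SOME t. t \<in> trees (alph A) \<and> accepts A q t)"

lemma witness:
  assumes "productive A q" shows "witness A q \<in> trees (alph A)" "accepts A q (witness A q)"
  using someI_ex[of "\<lambda>t. t \<in> trees (alph A) \<and> accepts A q t"] assms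
  unfolding witness_def productive_def by blast+

section \<open>Trees built along a path with prescribed side trees\<close>

primrec comb :: "(nat \<Rightarrow> 'a) \<Rightarrow> (nat \<Rightarrow> bool) \<Rightarrow> (nat \<Rightarrow> bool list \<Rightarrow> 'a) \<Rightarrow> bool list \<Rightarrow> 'a" where
  "comb l d s [] = l 0"
| "comb l d s (e # x) = (if e = d 0 then comb (l \<circ> Suc) (d \<circ> Suc) (s \<circ> Suc) x else s 0 x)"

lemma comb_pfx: "comb l d s (pfx d n @ y) = comb (\<lambda>i. l (n + i)) (\<lambda>i. d (n + i)) (\<lambda>i. s (n + i)) y"
proof (induction n arbitrary: y)
  case (Suc n)
  show ?case by (simp add: pfx_Suc Suc comp_def)
qed simp

lemma comb_trees:
  assumes "\<And>n. l n \<in> S" "\<And>n. s n \<in> trees S"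
  shows "comb l d s \<in> trees S"
proof -
  have "comb l d s x \<in> S" for x
    using assms
  proof (induction x arbitrary: l d s)
    case (Cons e x)
    then show ?case by (auto simp: trees_def)
  qed simp
  then show ?thesis by (simp add: trees_def)
qed

lemma comb_agree:
  assumes "\<And>n. n \<le> N \<Longrightarrow> l n = l' n \<and> d n = d' n \<and> agree N (s n) (s' n)"
  shows "agree N (comb l d s) (comb l' d' s')"
proof -
  have "comb l d s x = comb l' d' s' x"
    if "\<And>n. n \<le> length x \<Longrightarrow> l n = l' n \<and> d n = d' n \<and> agree (length x) (s n) (s' n)" for x
    using that
  proof (induction x arbitrary: l d s l' d' s')
    case (Cons e x)
    have "comb (l \<circ> Suc) (d \<circ> Suc) (s \<circ> Suc) x = comb (l' \<circ> Suc) (d' \<circ> Suc) (s' \<circ> Suc) x"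
      using Cons.prems by (intro Cons.IH) (auto simp: agree_def)
    moreover have "d 0 = d' 0" "s 0 x = s' 0 x" using Cons.prems[of 0] by (auto simp: agree_def)
    ultimately show ?case by simp
  qed simp
  then show ?thesis using assms unfolding agree_def by (meson le_trans)
qed

lemma accepts_comb:
  assumes "\<And>n. Q (Suc n) = child (d n) (trans A (Q n) (l n))"
  shows "accepts A (Q 0) (comb l d s) \<longleftrightarrow> parity_ok (rank A) Q \<and>
     (\<forall>n. accepts A (child (\<not> d n) (trans A (Q n) (l n))) (s n))"
proof -
  have l: "comb l d s (pfx d n) = l n" for n using comb_pfx[of l d s n "[]"] by simp
  have "subtree (comb l d s) (pfx d n @ [\<not> d n]) = s n" for n
    by (simp add: subtree_def comb_pfx)
  moreover have "run_from (trans A) (Q 0) (comb l d s) (pfx d n) = Q n" for n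
    by (induction n) (simp_all add: pfx_Suc run_from_snoc l assms)
  ultimately show ?thesis by (subst accepts_spine[of A _ _ d]) (simp add: l)
qed

text \<open>Each edge on the way puts one letter on top and a witness tree at the sibling. This
  pushes the argument one level down, so agreement depth is never lost.\<close>

lemma graft:
  assumes "reach A q p"
  obtains g where "\<And>t. t \<in> trees (alph A) \<Longrightarrow> g t \<in> trees (alph A)"
    and "\<And>t. accepts A q (g t) \<longleftrightarrow> accepts A p t"
    and "\<And>n s t. agree n s t \<Longrightarrow> agree n (g s) (g t)"
proof -
  have "\<exists>g. (\<forall>t\<in>trees (alph A). g t \<in> trees (alph A)) \<and> (\<forall>t. accepts A q (g t) \<longleftrightarrow> accepts A p t) \<and>
      (\<forall>n s t. agree n s t \<longrightarrow> agree n (g s) (g t))"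
    using assms unfolding reach_def
  proof (induction rule: converse_rtranclp_induct)
    case base
    show ?case by (intro exI[of _ id]) simp
  next
    case (step q q')
    then obtain g a d where e: "edge A q a d q'" and g: "\<forall>t\<in>trees (alph A). g t \<in> trees (alph A)"
      "\<forall>t. accepts A q' (g t) \<longleftrightarrow> accepts A p t" "\<forall>n s t. agree n s t \<longrightarrow> agree n (g s) (g t)" by blast
    define u where "u = witness A (child (\<not> d) (trans A q a))"
    have u: "u \<in> trees (alph A)" "accepts A (child (\<not> d) (trans A q a)) u"
      using e witness unfolding u_def edge_def by metis+
    define h where "h t x = (case x of [] \<Rightarrow> a | e # y \<Rightarrow> if e = d then g t y else u y)" for t x
    have "h t \<in> trees (alph A)" if "t \<in> trees (alph A)" for t
      using that g(1) u(1) e by (auto simp: h_def trees_def edge_def split: list.split)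
    moreover have "accepts A q (h t) \<longleftrightarrow> accepts A p t" for t
    proof -
      have "subtree (h t) [d] = g t" "subtree (h t) [\<not> d] = u" "h t [] = a"
        by (auto simp: h_def subtree_def)
      moreover have "q' = child d (trans A q a)" using e by (simp add: edge_def)
      ultimately show ?thesis using u(2) g(2) accepts_children[of A q "h t"]
        by (cases d) (auto simp: all_bool_eq)
    qed
    moreover have "agree n (h s) (h t)" if "agree n s t" for n s t
    proof -
      have "agree n (g s) (g t)" using g(3) that by blast
      then show ?thesis by (auto simp: h_def agree_def split: list.split)
    qed
    ultimately show ?case by (intro exI[of _ h]) blast
  qed
  then show thesis using that by blast
qed

text \<open>Used to bring two loops to a common length, so that they can alternate in blocks of
  equal size.\<close>

lemma is_loop_repeat:
  assumes "is_loop A p K m qs ls ds" and "c > 0"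
  shows "is_loop A p (c * K) m (\<lambda>i. qs (i mod K)) (\<lambda>i. ls (i mod K)) (\<lambda>i. ds (i mod K))"
proof -
  have K: "K > 0" and q: "qs 0 = p" "qs K = p" using assms(1) by (auto simp: is_loop_def)
  have edge: "edge A (qs (i mod K)) (ls (i mod K)) (ds (i mod K)) (qs (Suc i mod K))" for i
  proof -
    have "edge A (qs (i mod K)) (ls (i mod K)) (ds (i mod K)) (qs (Suc (i mod K)))"
      using assms(1) K by (simp add: is_loop_def)
    then show ?thesis using q by (cases "Suc (i mod K) = K") (simp_all add: mod_Suc)
  qed
  obtain i where "i < K" "rank A (qs i) = m" using assms(1) by (auto simp: is_loop_def)
  moreover have "K \<le> c * K" using assms(2) by simp
  ultimately have "\<exists>i<c * K. rank A (qs (i mod K)) = m" by (metis less_le_trans mod_less)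
  moreover have "\<forall>i. rank A (qs (i mod K)) \<le> m" using assms(1) K by (simp add: is_loop_def)
  ultimately show ?thesis using edge K assms(2) q by (simp add: is_loop_def)
qed

text \<open>Block i runs through loop i. All loops share the base p and the length K, so blocks join
  at p, and the largest recurring rank of the path is that of the sequence m.\<close>

lemma loop_sequence:
  fixes qs :: "nat \<Rightarrow> nat \<Rightarrow> 'q"
  assumes lp: "\<And>i. is_loop A p K (m i) (qs i) (ls i) (ds i)"
  defines "Q \<equiv> \<lambda>n. qs (n div K) (n mod K)"
  shows "edge A (Q n) (ls (n div K) (n mod K)) (ds (n div K) (n mod K)) (Q (Suc n))"
    and "infinite {i. m i = k} \<Longrightarrow> (\<And>i. i \<ge> N \<Longrightarrow> m i \<le> k) \<Longrightarrow> parity_ok (rank A) Q \<longleftrightarrow> even k"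
proof -
  have K: "K > 0" and q: "qs i 0 = p" "qs i K = p" for i using lp[of i] by (auto simp: is_loop_def)
  have "edge A (qs (n div K) (n mod K)) (ls (n div K) (n mod K)) (ds (n div K) (n mod K))
     (qs (n div K) (Suc (n mod K)))"
    using lp[of "n div K"] K by (simp add: is_loop_def)
  then show "edge A (Q n) (ls (n div K) (n mod K)) (ds (n div K) (n mod K)) (Q (Suc n))"
    using q by (auto simp: Q_def mod_Suc div_Suc)
  assume inf: "infinite {i. m i = k}" and bd: "\<And>i. i \<ge> N \<Longrightarrow> m i \<le> k"
  show "parity_ok (rank A) Q \<longleftrightarrow> even k"
  proof (rule parity_ok_iff_even)
    show "infinite {n. rank A (Q n) = k}"
      unfolding infinite_nat_iff_unbounded
    proof
      fix M
      obtain i where i: "i \<ge> M" "m i = k" using inf unfolding infinite_nat_iff_unbounded by blast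
      obtain c where c: "c < K" "rank A (qs i c) = k" using lp[of i] i by (auto simp: is_loop_def)
      have "rank A (Q (i * K + c)) = k" using c by (simp add: Q_def)
      moreover have "M \<le> i * K + c" using i K by (metis Suc_leI le_add1 le_trans mult.right_neutral mult_le_mono One_nat_def)
      ultimately show "\<exists>n\<ge>M. rank A (Q n) = k" by blast
    qed
    show "rank A (Q n) \<le> k" if "n \<ge> N * K" for n
    proof -
      have "N \<le> n div K" using that K by (simp add: less_eq_div_iff_mult_less_eq)
      then have "m (n div K) \<le> k" by (rule bd)
      moreover have "rank A (Q n) \<le> m (n div K)" using lp[of "n div K"] K by (simp add: is_loop_def Q_def)
      ultimately show ?thesis by simp
    qed
  qed
qed

text \<open>Block j runs through the odd loop if \<open>\<beta> j\<close> holds and through the even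
  loop otherwise. The odd rank is the larger one, so it decides exactly when \<beta> has infinitely
  many ones.\<close>

lemma flower_row:
  assumes "flower A p"
  obtains w where "\<And>\<beta>. w \<beta> \<in> trees (alph A)"
    and "\<And>\<beta>. accepts A p (w \<beta>) \<longleftrightarrow> finite {j::nat. \<beta> j}"
    and "\<And>N \<beta> \<beta>'. (\<And>j. j \<le> N \<Longrightarrow> \<beta> j = \<beta>' j) \<Longrightarrow> agree N (w \<beta>) (w \<beta>')"
proof -
  obtain k m K0 q0 l0 d0 K1 q1 l1 d1 where km: "even k" "odd m" "k < m"
    and l0: "is_loop A p K0 k q0 l0 d0" and l1: "is_loop A p K1 m q1 l1 d1"
    using assms unfolding flower_def has_loop_def by blast
  define K where "K = K0 * K1"
  have pos: "K0 > 0" "K1 > 0" using l0 l1 by (auto simp: is_loop_def)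
  define qs where "qs e i = (if e then q1 (i mod K1) else q0 (i mod K0))" for e i
  define ls where "ls e i = (if e then l1 (i mod K1) else l0 (i mod K0))" for e i
  define ds where "ds e i = (if e then d1 (i mod K1) else d0 (i mod K0))" for e i
  define mm where "mm e = (if e then m else k)" for e
  have lp: "is_loop A p K (mm e) (qs e) (ls e) (ds e)" for e
    using is_loop_repeat[OF l0 pos(2)] is_loop_repeat[OF l1 pos(1)]
    by (cases e) (simp_all add: qs_def[abs_def] ls_def[abs_def] ds_def[abs_def] mm_def K_def mult.commute)
  define L where "L \<beta> n = ls (\<beta> (n div K)) (n mod K)" for \<beta> n
  define D where "D \<beta> n = ds (\<beta> (n div K)) (n mod K)" for \<beta> n
  define Q where "Q \<beta> n = qs (\<beta> (n div K)) (n mod K)" for \<beta> n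
  define S where "S \<beta> n = child (\<not> D \<beta> n) (trans A (Q \<beta> n) (L \<beta> n))" for \<beta> n
  define w where "w \<beta> = comb (L \<beta>) (D \<beta>) (\<lambda>n. witness A (S \<beta> n))" for \<beta>
  have edge: "edge A (Q \<beta> n) (L \<beta> n) (D \<beta> n) (Q \<beta> (Suc n))" for \<beta> n
    using loop_sequence(1)[of A p K "\<lambda>i. mm (\<beta> i)" "\<lambda>i. qs (\<beta> i)"
      "\<lambda>i. ls (\<beta> i)" "\<lambda>i. ds (\<beta> i)" n] lp unfolding L_def D_def Q_def by blast
  then have prod: "productive A (S \<beta> n)" for \<beta> n unfolding edge_def S_def by blast
  have "w \<beta> \<in> trees (alph A)" for \<beta>
    unfolding w_def using edge witness(1)[OF prod] by (intro comb_trees) (auto simp: edge_def)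
  moreover have "accepts A p (w \<beta>) \<longleftrightarrow> finite {j. \<beta> j}" for \<beta>
  proof -
    have par: "parity_ok (rank A) (Q \<beta>) \<longleftrightarrow> even k'" if "infinite {i. mm (\<beta> i) = k'}" "\<And>i. i \<ge> N \<Longrightarrow> mm (\<beta> i) \<le> k'" for k' N
      using loop_sequence(2)[of A p K "\<lambda>i. mm (\<beta> i)" "\<lambda>i. qs (\<beta> i)" "\<lambda>i. ls (\<beta> i)" "\<lambda>i. ds (\<beta> i)" k' N,
        OF lp that] unfolding Q_def .
    have "parity_ok (rank A) (Q \<beta>) \<longleftrightarrow> finite {j. \<beta> j}"
    proof (cases "finite {j. \<beta> j}")
      case True
      then obtain N where N: "\<And>j. j \<ge> N \<Longrightarrow> \<not> \<beta> j" unfolding finite_nat_iff_eventually_not by blast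
      then have "infinite {i. mm (\<beta> i) = k}" unfolding infinite_nat_iff_unbounded mm_def
        by (metis nle_le)
      then show ?thesis using par[of k N] N km True by (simp add: mm_def)
    next
      case False
      have "{j. \<beta> j} \<subseteq> {i. mm (\<beta> i) = m}" by (auto simp: mm_def)
      then have "infinite {i. mm (\<beta> i) = m}" using False finite_subset by blast
      then show ?thesis using par[of m 0] km False by (simp add: mm_def)
    qed
    moreover have "Q \<beta> 0 = p" using lp by (simp add: Q_def is_loop_def)
    moreover have "Q \<beta> (Suc n) = child (D \<beta> n) (trans A (Q \<beta> n) (L \<beta> n))" for n
      using edge by (simp add: edge_def)
    ultimately show ?thesis using accepts_comb[of "Q \<beta>" "D \<beta>" A "L \<beta>" "\<lambda>n. witness A (S \<beta> n)"] witness(2)[OF prod]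
      by (simp add: w_def S_def)
  qed
  moreover have "agree N (w \<beta>) (w \<beta>')" if "\<And>j. j \<le> N \<Longrightarrow> \<beta> j = \<beta>' j" for N \<beta> \<beta>'
    unfolding w_def
  proof (rule comb_agree)
    fix n assume "n \<le> N"
    then have "\<beta> (n div K) = \<beta>' (n div K)" by (intro that) (meson div_le_dividend le_trans)
    then show "L \<beta> n = L \<beta>' n \<and> D \<beta> n = D \<beta>' n \<and> agree N (witness A (S \<beta> n)) (witness A (S \<beta>' n))"
      by (simp add: L_def D_def S_def Q_def agree_def)
  qed
  ultimately show thesis by (rule that)
qed

text \<open>A comb goes round the accepting loop forever; at its i-th passage through p the side
  tree encodes row i of a matrix, grafted onto the flower. The tree is accepted iff all rows are
  finite, so a \<open>\<Sigma>\<^sup>0\<^sub>3\<close> presentation would pull back to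
  \<open>finite_rows\<close>.\<close>

lemma Sigma3_no_replicated_flower:
  assumes Sig: "lang A \<in> borel_Sigma (trees (alph A)) 3"
  shows "\<not> replicated_flower A"
proof
  assume "replicated_flower A"
  then obtain p K m qs ls ds where rp: "reach A (init A) p" and lp: "is_loop A p K m qs ls ds"
    and m: "even m" and al: "alive A (child (\<not> ds 0) (trans A p (ls 0)))"
    unfolding replicated_flower_def by blast
  let ?\<sigma> = "child (\<not> ds 0) (trans A p (ls 0))"
  from al obtain f where rf: "reach A ?\<sigma> f" and fl: "flower A f" by (auto simp: alive_def)
  obtain g1 where g1: "\<And>t. t \<in> trees (alph A) \<Longrightarrow> g1 t \<in> trees (alph A)"
    "\<And>t. accepts A (init A) (g1 t) \<longleftrightarrow> accepts A p t" "\<And>n s t. agree n s t \<Longrightarrow> agree n (g1 s) (g1 t)"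
    using graft[OF rp] by blast
  obtain g2 where g2: "\<And>t. t \<in> trees (alph A) \<Longrightarrow> g2 t \<in> trees (alph A)"
    "\<And>t. accepts A ?\<sigma> (g2 t) \<longleftrightarrow> accepts A f t" "\<And>n s t. agree n s t \<Longrightarrow> agree n (g2 s) (g2 t)"
    using graft[OF rf] by blast
  obtain w where w: "\<And>\<beta>. w \<beta> \<in> trees (alph A)" "\<And>\<beta>. accepts A f (w \<beta>) \<longleftrightarrow> finite {j::nat. \<beta> j}"
    "\<And>N \<beta> \<beta>'. (\<And>j. j \<le> N \<Longrightarrow> \<beta> j = \<beta>' j) \<Longrightarrow> agree N (w \<beta>) (w \<beta>')"
    using flower_row[OF fl] by blast
  define Q where "Q n = qs (n mod K)" for n
  define L where "L n = ls (n mod K)" for n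
  define D where "D n = ds (n mod K)" for n
  define S where "S n = child (\<not> D n) (trans A (Q n) (L n))" for n
  define side where "side \<alpha> n = (if n mod K = 0 then g2 (w (\<alpha> (n div K))) else witness A (S n))" for \<alpha> n
  define \<tau> where "\<tau> \<alpha> = g1 (comb L D (side \<alpha>))" for \<alpha>
  have K: "K > 0" and q0: "qs 0 = p" using lp by (auto simp: is_loop_def)
  have edge: "edge A (Q n) (L n) (D n) (Q (Suc n))" for n
    using loop_sequence(1)[of A p K "\<lambda>_. m" "\<lambda>_. qs" "\<lambda>_. ls" "\<lambda>_. ds" n] lp unfolding L_def D_def Q_def by blast
  then have prod: "productive A (S n)" for n unfolding edge_def S_def by blast
  have side: "side \<alpha> n \<in> trees (alph A)" for \<alpha> n
    using g2(1) w(1) witness(1)[OF prod] by (simp add: side_def)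
  have trees: "\<tau> \<alpha> \<in> trees (alph A)" for \<alpha>
    unfolding \<tau>_def using edge side by (intro g1(1) comb_trees) (auto simp: edge_def)
  have acc: "\<tau> \<alpha> \<in> lang A \<longleftrightarrow> \<alpha> \<in> finite_rows" for \<alpha>
  proof -
    have "parity_ok (rank A) Q"
      using loop_sequence(2)[of A p K "\<lambda>_. m" "\<lambda>_. qs" _ _ m 0] lp m unfolding Q_def by simp
    moreover have "Q 0 = p" using q0 by (simp add: Q_def)
    moreover have "Q (Suc n) = child (D n) (trans A (Q n) (L n))" for n using edge by (simp add: edge_def)
    ultimately have "accepts A p (comb L D (side \<alpha>)) \<longleftrightarrow> (\<forall>n. accepts A (S n) (side \<alpha> n))"
      using accepts_comb[of Q D A L "side \<alpha>"] by (simp add: S_def)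
    also have "\<dots> \<longleftrightarrow> (\<forall>i. finite {j. \<alpha> i j})"
    proof -
      have S0: "n mod K = 0 \<Longrightarrow> S n = ?\<sigma>" for n by (simp add: S_def D_def Q_def L_def q0)
      have "accepts A (S n) (side \<alpha> n) \<longleftrightarrow> (n mod K = 0 \<longrightarrow> finite {j. \<alpha> (n div K) j})" for n
        using S0 g2(2) w(2) witness(2)[OF prod] by (simp add: side_def)
      moreover have "(\<forall>n. n mod K = 0 \<longrightarrow> finite {j. \<alpha> (n div K) j}) \<longleftrightarrow> (\<forall>i. finite {j. \<alpha> i j})"
        using K by (metis mod_mult_self2_is_0 nonzero_mult_div_cancel_right less_numeral_extra(3))
      ultimately show ?thesis by simp
    qed
    finally show ?thesis using trees by (simp add: lang_accepts \<tau>_def g1(2) finite_rows_def)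
  qed
  \<comment> \<open>Depth N involves row and column indices up to N inclusive, hence a square of
    side N + 1.\<close>
  have agree: "agree N (\<tau> \<alpha>) (\<tau> \<beta>)" if ag: "square_agree (Suc N) \<alpha> \<beta>" for N \<alpha> \<beta>
    unfolding \<tau>_def
  proof (intro g1(3) comb_agree conjI refl)
    fix n assume n: "n \<le> N"
    then have "n div K \<le> N" by (meson div_le_dividend le_trans)
    then show "agree N (side \<alpha> n) (side \<beta> n)"
      using ag by (auto simp: side_def agree_def[of N "witness A (S n)"] square_agree_def intro!: g2(3) w(3))
  qed
  from Sig obtain V :: "nat \<Rightarrow> nat \<Rightarrow> _" where V: "\<And>i j. tree_open (trees (alph A)) (V i j)"
    and L: "lang A = (\<Union>i. trees (alph A) \<inter> (\<Inter>j. V i j))"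
    unfolding borel_Sigma_3 by blast
  have "square_open {\<alpha>. \<tau> \<alpha> \<in> V i j}" for i j
    unfolding square_open_def
  proof
    fix \<alpha> assume "\<alpha> \<in> {\<alpha>. \<tau> \<alpha> \<in> V i j}"
    then obtain n where n: "\<And>s. s \<in> trees (alph A) \<Longrightarrow> agree n s (\<tau> \<alpha>) \<Longrightarrow> s \<in> V i j"
      using V[of i j] unfolding tree_open_iff by blast
    have "\<tau> \<beta> \<in> V i j" if "square_agree (Suc n) \<alpha> \<beta>" for \<beta>
      using agree[of n \<beta> \<alpha>] that by (intro n trees) (auto simp: square_agree_def)
    then show "\<exists>N. \<forall>\<beta>. square_agree N \<alpha> \<beta> \<longrightarrow> \<beta> \<in> {\<alpha>. \<tau> \<alpha> \<in> V i j}" by blast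
  qed
  then have "finite_rows \<noteq> (\<Union>i. \<Inter>j. {\<alpha>. \<tau> \<alpha> \<in> V i j})" by (rule finite_rows_not_Sigma3)
  moreover have "\<alpha> \<in> finite_rows \<longleftrightarrow> \<alpha> \<in> (\<Union>i. \<Inter>j. {\<alpha>. \<tau> \<alpha> \<in> V i j})" for \<alpha>
    using trees[of \<alpha>] unfolding acc[symmetric] L by simp
  then have "finite_rows = (\<Union>i. \<Inter>j. {\<alpha>. \<tau> \<alpha> \<in> V i j})" by (rule set_eqI)
  ultimately show False by simp
qed

subsection \<open>The language of H\<close>

lemma H_simps [simp]:
  "states H = UNIV" "alph H = UNIV" "init H = P0" "trans H = H_trans" "rank H = H_rank"
  by (simp_all add: H_def)

lemma trees_UNIV [simp]: "trees UNIV = UNIV"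
  by (simp add: trees_def)

lemma H_trans_sink:
  "q \<in> {CA, C0, Top} \<Longrightarrow> child d (H_trans q a) \<in> {CA, C0, Top}"
  by (cases q; cases a) (auto simp: child_def)

text \<open>The copies of \<open>C_1\<close> can only reach states of rank 0, so they accept
  everything, as \<open>Top\<close> does.\<close>

lemma accepts_H_sink:
  assumes "q \<in> {CA, C0, Top}"
  shows "accepts H q t"
proof -
  have "run_from H_trans q t x \<in> {CA, C0, Top}" for x
  proof (induction x rule: rev_induct)
    case (snoc d x)
    then show ?case unfolding run_from_snoc by (rule H_trans_sink)
  qed (use assms in simp)
  then have "H_rank (run_from H_trans q t x) = 0" for x
    by (metis H_rank.simps(3,4,8) empty_iff insert_iff)
  then have "parity_ok H_rank (\<lambda>n. run_from H_trans q t (pfx \<pi> n)) \<longleftrightarrow> even (0::nat)" for \<pi>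
    by (intro parity_ok_iff_even[where N = 0]) simp_all
  then show ?thesis by (simp add: accepts_def)
qed

text \<open>With ranks up to 2 the parity condition is a single Streett pair, the format of the
  tests below.\<close>

lemma parity_ok_012:
  assumes "\<And>n. rk (s n) \<le> 2"
  shows "parity_ok rk s \<longleftrightarrow> finite {n. rk (s n) = 1} \<or> infinite {n. rk (s n) = 2}"
proof (cases "infinite {n. rk (s n) = 2}")
  case True
  then show ?thesis using parity_ok_iff_even[of rk s 2 0] assms by simp
next
  case fin2: False
  then obtain N where N: "\<And>n. n \<ge> N \<Longrightarrow> rk (s n) \<noteq> 2" unfolding finite_nat_iff_eventually_not by blast
  then have le: "n \<ge> N \<Longrightarrow> rk (s n) \<le> 1" for n using assms[of n] by (metis One_nat_def Suc_1 le_SucE)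
  show ?thesis
  proof (cases "infinite {n. rk (s n) = 1}")
    case True
    then show ?thesis using parity_ok_iff_even[of rk s 1 N] le fin2 by simp
  next
    case False
    then obtain M where M: "\<And>n. n \<ge> M \<Longrightarrow> rk (s n) \<noteq> 1" unfolding finite_nat_iff_eventually_not by blast
    have z: "rk (s n) = 0" if "n \<ge> max M N" for n
      using M[of n] le[of n] that by linarith
    then have "infinite {n. rk (s n) = 0}" unfolding infinite_nat_iff_unbounded by (metis nle_le)
    then show ?thesis using parity_ok_iff_even[of rk s 0 "max M N"] z False by simp
  qed
qed

lemma H_rank_le_2: "H_rank q \<le> 2"
  by (cases q) simp_all

text \<open>Apart from spawning \<open>R0\<close> at \<open>P0\<close> on \<open>a1\<close>, all
  right targets of \<open>H\<close> are all-accepting, so parity matters only on leftmost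
  branches.\<close>

definition spine :: "hstate \<Rightarrow> (bool list \<Rightarrow> letter) \<Rightarrow> nat \<Rightarrow> hstate" where
  "spine q t n = run_from H_trans q t (replicate n False)"

lemma spine_0 [simp]: "spine q t 0 = q"
  by (simp add: spine_def)

lemma spine_Suc: "spine q t (Suc n) = fst (H_trans (spine q t n) (t (replicate n False)))"
  unfolding spine_def
  by (metis child_def replicate_Suc replicate_append_same run_from_snoc)

lemma accepts_H_spine:
  "accepts H q t \<longleftrightarrow> (finite {n. H_rank (spine q t n) = 1} \<or> infinite {n. H_rank (spine q t n) = 2}) \<and>
     (\<forall>n. accepts H (snd (H_trans (spine q t n) (t (replicate n False))))
        (subtree t (replicate n False @ [True])))"
  using parity_ok_012[of H_rank "spine q t", OF H_rank_le_2]
  by (subst accepts_spine[where d = "\<lambda>_. False"])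
     (simp add: pfx_False child_def spine_def[symmetric] spine_def[abs_def, symmetric])

lemma accepts_H_R0:
  "accepts H R0 t \<longleftrightarrow> finite {n. H_rank (spine R0 t n) = 1} \<or> infinite {n. H_rank (spine R0 t n) = 2}"
proof -
  have st: "spine R0 t n \<in> {R0, R1, R2, Top}" for n
  proof (induction n)
    case (Suc n)
    then show ?case by (cases "t (replicate n False)") (auto simp: spine_Suc)
  qed simp
  have "snd (H_trans (spine R0 t n) (t (replicate n False))) = Top" for n
    using st[of n] by (cases "t (replicate n False)") auto
  then show ?thesis by (subst accepts_H_spine) (simp add: accepts_H_sink)
qed

lemma accepts_H_P0:
  "accepts H P0 t \<longleftrightarrow> finite {n. H_rank (spine P0 t n) = 1} \<and>
     (\<forall>n. spine P0 t n = P0 \<and> t (replicate n False) = a1 \<longrightarrow>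
        accepts H R0 (subtree t (replicate n False @ [True])))"
proof -
  have st: "spine P0 t n \<in> {P0, P1, CA, Top}" for n
  proof (induction n)
    case (Suc n)
    then show ?case by (cases "t (replicate n False)") (auto simp: spine_Suc)
  qed simp
  have "H_rank (spine P0 t n) \<noteq> 2" for n
    using st[of n] by auto
  then have no2: "{n. H_rank (spine P0 t n) = 2} = {}" by simp
  have "accepts H (snd (H_trans q a)) u \<longleftrightarrow> (q = P0 \<and> a = a1 \<longrightarrow> accepts H R0 u)"
    if "q \<in> {P0, P1, CA, Top}" for q a u
    using that by (cases q; cases a) (simp_all add: accepts_H_sink)
  from this[OF st] have "accepts H (snd (H_trans (spine P0 t n) (t (replicate n False)))) u \<longleftrightarrow>
     (spine P0 t n = P0 \<and> t (replicate n False) = a1 \<longrightarrow> accepts H R0 u)" for n u .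
  then show ?thesis by (subst accepts_H_spine) (simp add: no2)
qed

text \<open>Every step takes two letters on the leftmost branch, because \<open>H\<close> needs two letters
to go from \<open>P0\<close> through \<open>P1\<close> back to \<open>P0\<close> (and likewise inside a
test): \<open>c m\<close> spawns test \<open>m\<close>, in which \<open>\<phi> m k\<close> and
\<open>\<psi> m k\<close> produce a visit to rank 1 and 2. Labels off these branches are irrelevant,
as \<open>H\<close> is in an all-accepting state there.\<close>

definition htree :: "(nat \<Rightarrow> bool) \<Rightarrow> (nat \<Rightarrow> nat \<Rightarrow> bool) \<Rightarrow> (nat \<Rightarrow> nat \<Rightarrow> bool) \<Rightarrow> bool list \<Rightarrow> letter" where
  "htree c \<phi> \<psi> x = (case dropWhile Not x of
       [] \<Rightarrow> if c (length x div 2) then a1 else a0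
     | _ # y \<Rightarrow> let m = (length x - Suc (length y)) div 2; k = length y div 2
         in if \<psi> m k then a2 else if \<phi> m k then a1 else a0)"

lemma htree_spine: "htree c \<phi> \<psi> (replicate n False) = (if c (n div 2) then a1 else a0)"
  by (simp add: htree_def dropWhile_replicate)

lemma htree_branch: "subtree (htree c \<phi> \<psi>) (replicate n False @ [True]) =
   (\<lambda>y. if \<psi> (n div 2) (length y div 2) then a2 else if \<phi> (n div 2) (length y div 2) then a1 else a0)"
proof -
  have "dropWhile Not (replicate n False @ True # y) = True # y" for y
    by (induction n) simp_all
  then show ?thesis by (simp add: subtree_def htree_def Let_def cong: if_cong)
qed

lemma finite_odd_iff: "finite {n. odd n \<and> P (n div 2)} \<longleftrightarrow> finite {m::nat. P m}"
proof -
  have "{n. odd n \<and> P (n div 2)} = (\<lambda>m. 2 * m + 1) ` {m. P m}"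
    by (auto elim!: oddE)
  then show ?thesis by (simp add: finite_image_iff inj_on_def)
qed

lemma accepts_H_htree:
  "accepts H P0 (htree c \<phi> \<psi>) \<longleftrightarrow>
     finite {m. c m} \<and> (\<forall>m. c m \<longrightarrow> finite {k. \<phi> m k} \<or> infinite {k. \<psi> m k})"
proof -
  have sp: "spine P0 (htree c \<phi> \<psi>) n = (if odd n \<and> c (n div 2) then P1 else P0)" for n
    by (induction n) (auto simp: spine_Suc htree_spine)
  have R: "accepts H R0 (\<lambda>y. if p (length y div 2) then a2 else if f (length y div 2) then a1 else a0)
      \<longleftrightarrow> finite {k. f k} \<or> infinite {k. p k}" for p f
  proof -
    let ?t = "\<lambda>y::bool list. if p (length y div 2) then a2 else if f (length y div 2) then a1 else a0"
    have sp: "spine R0 ?t n = (if odd n then if p (n div 2) then R2 else if f (n div 2) then R1 else R0 else R0)" for n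
      by (induction n) (auto simp: spine_Suc)
    have "{n. H_rank (spine R0 ?t n) = 1} = {n. odd n \<and> f (n div 2) \<and> \<not> p (n div 2)}"
      "{n. H_rank (spine R0 ?t n) = 2} = {n. odd n \<and> p (n div 2)}"
      unfolding sp by auto
    then have "accepts H R0 ?t \<longleftrightarrow> finite {k. f k \<and> \<not> p k} \<or> infinite {k. p k}"
      using finite_odd_iff[of p] finite_odd_iff[of "\<lambda>k. f k \<and> \<not> p k"] by (simp add: accepts_H_R0)
    \<comment> \<open>The letter \<open>a2\<close> takes precedence and masks some events of f; if p
      holds only finitely often, only finitely many are masked.\<close>
    moreover have "finite {k. f k}" if "finite {k. f k \<and> \<not> p k}" "finite {k. p k}"
      using finite_UnI[OF that] by (rule rev_finite_subset) auto
    moreover have "finite {k. f k \<and> \<not> p k}" if "finite {k. f k}"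
      using that by (rule rev_finite_subset) auto
    ultimately show ?thesis by blast
  qed
  have "{n. H_rank (spine P0 (htree c \<phi> \<psi>) n) = 1} = {n. odd n \<and> c (n div 2)}"
    unfolding sp by auto
  \<comment> \<open>Positions 2m and 2m + 1 both carry \<open>a1\<close> when \<open>c m\<close>
    holds, but only at the even one is \<open>H\<close> in \<open>P0\<close>, so test m is spawned
    once.\<close>
  then have "accepts H P0 (htree c \<phi> \<psi>) \<longleftrightarrow> finite {m. c m} \<and>
     (\<forall>n. even n \<and> c (n div 2) \<longrightarrow> finite {k. \<phi> (n div 2) k} \<or> infinite {k. \<psi> (n div 2) k})"
    by (subst accepts_H_P0) (auto simp: finite_odd_iff sp htree_spine htree_branch R)
  also have "\<dots> \<longleftrightarrow> finite {m. c m} \<and> (\<forall>m. c m \<longrightarrow> finite {k. \<phi> m k} \<or> infinite {k. \<psi> m k})"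
    by (metis even_mult_iff even_numeral nonzero_mult_div_cancel_left zero_neq_numeral)
  finally show ?thesis .
qed

section \<open>Finite dependence and closure properties of \<open>Sigma3\<close>\<close>

text \<open>The depth bound is uniform over all labelings, which makes Boolean instances clopen. The
  labels may be letters or, for runs, states.\<close>

definition local :: "((bool list \<Rightarrow> 'a) \<Rightarrow> 'c) \<Rightarrow> bool" where
  "local f \<longleftrightarrow> (\<exists>n. \<forall>s t. agree n s t \<longrightarrow> f s = f t)"

lemma local_comp: "local f \<Longrightarrow> local (\<lambda>t. F (f t))"
  unfolding local_def by metis

lemma local_comp2:
  assumes "local f" "local g" shows "local (\<lambda>t. F (f t) (g t))"
proof -
  obtain m n where mn: "\<And>s t. agree m s t \<Longrightarrow> f s = f t" "\<And>s t. agree n s t \<Longrightarrow> g s = g t"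
    using assms unfolding local_def by blast
  have "F (f s) (g s) = F (f t) (g t)" if "agree (max m n) s t" for s t
    using mn[of s t] that by (simp add: agree_def)
  then show ?thesis unfolding local_def by blast
qed

lemma local_label: "local (\<lambda>t. t x)"
  unfolding local_def agree_def by blast

lemma local_run: "local (\<lambda>t. run_from \<delta> q (subtree t x) y)"
  unfolding local_def
proof (intro exI allI impI)
  fix s t :: "bool list \<Rightarrow> 'a" assume "agree (length x + length y) s t"
  then have "agree (length y) (subtree s x) (subtree t x)" by (simp add: agree_def subtree_def)
  then show "run_from \<delta> q (subtree s x) y = run_from \<delta> q (subtree t x) y" by (rule run_from_agree) simp
qed

text \<open>A quantifier normal form with a clopen matrix, on the space of all labelings; this suits
  \<open>H\<close>, whose alphabet is \<open>UNIV\<close>.\<close>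

definition Sigma3 :: "((bool list \<Rightarrow> 'a) \<Rightarrow> bool) \<Rightarrow> bool" where
  "Sigma3 P \<longleftrightarrow> (\<exists>R :: nat \<Rightarrow> nat \<Rightarrow> nat \<Rightarrow> _. (\<forall>i j k. local (R i j k)) \<and>
     (\<forall>t. P t \<longleftrightarrow> (\<exists>i. \<forall>j. \<exists>k. R i j k t)))"

lemma Sigma3_borel:
  assumes "Sigma3 P" shows "{t. P t} \<in> borel_Sigma UNIV 3"
proof -
  obtain R :: "nat \<Rightarrow> nat \<Rightarrow> nat \<Rightarrow> _" where R: "\<And>i j k. local (R i j k)" "\<And>t. P t \<longleftrightarrow> (\<exists>i. \<forall>j. \<exists>k. R i j k t)"
    using assms unfolding Sigma3_def by blast
  have "tree_open UNIV {t. \<exists>k. R i j k t}" for i j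
    unfolding tree_open_iff using R(1) unfolding local_def by blast
  moreover have "{t. P t} = (\<Union>i. UNIV \<inter> (\<Inter>j. {t. \<exists>k. R i j k t}))" unfolding R(2) by auto
  ultimately show ?thesis unfolding borel_Sigma_3
    by (intro CollectI exI[of _ "\<lambda>i j. {t. \<exists>k. R i j k t}"]) simp
qed

lemma Sigma3_all_ex:
  assumes "\<And>j k. local (R j k)" shows "Sigma3 (\<lambda>t. \<forall>j::nat. \<exists>k::nat. R j k t)"
  unfolding Sigma3_def by (intro exI[of _ "\<lambda>_. R"]) (simp add: assms)

lemma Sigma3_all:
  assumes "\<And>j. local (R j)" shows "Sigma3 (\<lambda>t. \<forall>j::nat. R j t)"
  using Sigma3_all_ex[of "\<lambda>j _. R j"] assms by simp

lemma Sigma3_local: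
  assumes "local P" shows "Sigma3 P"
  using Sigma3_all[of "\<lambda>_. P"] assms by simp

lemma Sigma3_ex:
  assumes "\<And>i::nat. Sigma3 (P i)" shows "Sigma3 (\<lambda>t. \<exists>i. P i t)"
proof -
  obtain R :: "nat \<Rightarrow> nat \<Rightarrow> nat \<Rightarrow> nat \<Rightarrow> _" where R: "\<And>l i j k. local (R l i j k)"
     "\<And>l t. P l t \<longleftrightarrow> (\<exists>i. \<forall>j. \<exists>k. R l i j k t)"
    using assms unfolding Sigma3_def by metis
  have "(\<exists>i. P i t) \<longleftrightarrow> (\<exists>p. \<forall>j. \<exists>k. R (fst (prod_decode p)) (snd (prod_decode p)) j k t)" for t
    unfolding R(2) by (metis fst_conv snd_conv prod_encode_inverse)
  then show ?thesis unfolding Sigma3_def using R(1)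
    by (intro exI[of _ "\<lambda>p. R (fst (prod_decode p)) (snd (prod_decode p))"]) simp
qed

lemma Sigma3_disj:
  assumes "Sigma3 P" "Sigma3 Q" shows "Sigma3 (\<lambda>t. P t \<or> Q t)"
proof -
  have "Sigma3 (\<lambda>t. \<exists>i::nat. (if i = 0 then P else Q) t)"
    by (rule Sigma3_ex) (simp add: assms)
  moreover have "(\<exists>i::nat. (if i = 0 then P else Q) t) \<longleftrightarrow> P t \<or> Q t" for t
    by (metis zero_neq_one)
  ultimately show ?thesis by simp
qed

text \<open>The two outer witnesses are coded as a pair, and the universal index serves R at even
  values and S at odd ones.\<close>

lemma Sigma3_conj:
  assumes "Sigma3 P" "Sigma3 Q" shows "Sigma3 (\<lambda>t. P t \<and> Q t)"
proof -
  obtain R :: "nat \<Rightarrow> nat \<Rightarrow> nat \<Rightarrow> _" where R: "\<And>i j k. local (R i j k)" "\<And>t. P t \<longleftrightarrow> (\<exists>i. \<forall>j. \<exists>k. R i j k t)"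
    using assms(1) unfolding Sigma3_def by blast
  obtain S :: "nat \<Rightarrow> nat \<Rightarrow> nat \<Rightarrow> _" where S: "\<And>i j k. local (S i j k)" "\<And>t. Q t \<longleftrightarrow> (\<exists>i. \<forall>j. \<exists>k. S i j k t)"
    using assms(2) unfolding Sigma3_def by blast
  define W where "W p j = (if even j then R (fst (prod_decode p)) (j div 2) else S (snd (prod_decode p)) (j div 2))"
    for p j :: nat
  have parity: "(\<forall>j::nat. if even j then A (j div 2) else B (j div 2)) \<longleftrightarrow> (\<forall>j. A j) \<and> (\<forall>j. B j)" for A B
  proof safe
    fix j assume *: "\<forall>j::nat. if even j then A (j div 2) else B (j div 2)"
    show "A j" using *[rule_format, of "2 * j"] by simp
    show "B j" using *[rule_format, of "Suc (2 * j)"] by simp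
  qed auto
  have "(\<forall>j. \<exists>k. W p j k t) \<longleftrightarrow> (\<forall>j. \<exists>k. R (fst (prod_decode p)) j k t) \<and> (\<forall>j. \<exists>k. S (snd (prod_decode p)) j k t)" for p t
    unfolding parity[symmetric] W_def by (simp add: if_distrib cong: if_cong)
  then have "P t \<and> Q t \<longleftrightarrow> (\<exists>p. \<forall>j. \<exists>k. W p j k t)" for t
    unfolding R(2) S(2) by (metis fst_conv snd_conv prod_encode_inverse)
  moreover have "local (W p j k)" for p j k using R(1) S(1) by (simp add: W_def)
  ultimately show ?thesis unfolding Sigma3_def by blast
qed

lemma Sigma3_all_less:
  assumes "\<And>m. Sigma3 (P m)" shows "Sigma3 (\<lambda>t. \<forall>m<N::nat. P m t)"
proof (induction N)
  case (Suc N)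
  have "(\<forall>m<Suc N. P m t) \<longleftrightarrow> (\<forall>m<N. P m t) \<and> P N t" for t using less_Suc_eq by auto
  then show ?case using Sigma3_conj[OF Suc assms[of N]] by simp
qed (use Sigma3_local[of "\<lambda>_. True"] in \<open>simp add: local_def\<close>)

lemma Sigma3_infinite:
  assumes "\<And>n::nat. local (R n)" shows "Sigma3 (\<lambda>t. infinite {n. R n t})"
  unfolding infinite_nat_iff_unbounded
  by (rule Sigma3_all_ex) (rule local_comp[OF assms])

lemma Sigma3_finite:
  assumes "\<And>n::nat. local (R n)" shows "Sigma3 (\<lambda>t. finite {n. R n t})"
  unfolding finite_nat_iff_eventually_not
  by (intro Sigma3_ex Sigma3_all) (rule local_comp[OF assms])

text \<open>The complement is directly \<open>\<Sigma>\<^sup>0\<^sub>3\<close>. For the language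
  itself, the conjunction over all spawned tests must be made finite: each spawn causes a visit to
  rank 1 one step later, so a bound on these visits bounds the spawns.\<close>

lemma lang_H_Delta3: "lang H \<in> borel_Delta (trees (alph H)) 3"
proof -
  define main where "main n t \<longleftrightarrow> H_rank (spine P0 t n) = 1" for n and t :: "bool list \<Rightarrow> letter"
  define spawn where "spawn n t \<longleftrightarrow> spine P0 t n = P0 \<and> t (replicate n False) = a1" for n and t :: "bool list \<Rightarrow> letter"
  define rk where "rk n k t = H_rank (spine R0 (subtree t (replicate n False @ [True])) k)" for n k and t :: "bool list \<Rightarrow> letter"
  have lm: "local (main n)" for n
    using local_comp[OF local_run[of H_trans P0 "[]" "replicate n False"], of "\<lambda>q. H_rank q = 1"]
    by (simp add: main_def[abs_def] spine_def)
  have ls: "local (spawn n)" for n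
    using local_comp2[OF local_run[of H_trans P0 "[]" "replicate n False"] local_label, of "\<lambda>q a. q = P0 \<and> a = a1"]
    by (simp add: spawn_def[abs_def] spine_def)
  have lr: "local (\<lambda>t. rk n k t = v)" for n k v
    using local_comp[OF local_run[of H_trans R0 "replicate n False @ [True]" "replicate k False"], of "\<lambda>q. H_rank q = v"]
    by (simp add: rk_def spine_def)
  have L: "accepts H P0 t \<longleftrightarrow> finite {n. main n t} \<and>
      (\<forall>n. spawn n t \<longrightarrow> finite {k. rk n k t = 1} \<or> infinite {k. rk n k t = 2})" for t
    by (subst accepts_H_P0) (simp add: accepts_H_R0 main_def spawn_def rk_def)
  have sm: "spawn n t \<Longrightarrow> main (Suc n) t" for n t
    by (simp add: spawn_def main_def spine_Suc)
  have L': "accepts H P0 t \<longleftrightarrow> (\<exists>N. (\<forall>n. n \<ge> N \<longrightarrow> \<not> main n t) \<and>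
      (\<forall>n<N. \<not> spawn n t \<or> finite {k. rk n k t = 1} \<or> infinite {k. rk n k t = 2}))" for t
    unfolding L finite_nat_iff_eventually_not[of "\<lambda>n. main n t"] using sm
    by (meson le_SucI linorder_not_le)
  have "Sigma3 (accepts H P0)"
    unfolding L'
    by (intro Sigma3_ex Sigma3_conj Sigma3_all Sigma3_all_less Sigma3_disj Sigma3_finite Sigma3_infinite
        Sigma3_local[OF local_comp[OF ls]] local_comp[OF lm] lr)
  moreover have "Sigma3 (\<lambda>t. \<not> accepts H P0 t)"
  proof -
    have "\<not> accepts H P0 t \<longleftrightarrow> infinite {n. main n t} \<or>
      (\<exists>n. spawn n t \<and> infinite {k. rk n k t = 1} \<and> finite {k. rk n k t = 2})" for t
      unfolding L by blast
    then show ?thesis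
      by (simp only:) (intro Sigma3_ex Sigma3_conj Sigma3_disj Sigma3_finite Sigma3_infinite Sigma3_local ls lm lr)
  qed
  moreover have "lang H = {t. accepts H P0 t}" "lang H = UNIV - {t. \<not> accepts H P0 t}"
    by (auto simp: lang_accepts)
  ultimately show ?thesis unfolding borel_Delta_def borel_Pi_def
    using Sigma3_borel[of "accepts H P0"] Sigma3_borel[of "\<lambda>t. \<not> accepts H P0 t"] by auto
qed

subsection \<open>The reduction\<close>

text \<open>From p at a time beyond N, go on to an occurrence of rank k and then to a later return
  to p; no larger rank can interfere.\<close>

lemma sequence_loop:
  assumes edge: "\<And>n. edge A (s n) (l n) (d n) (s (Suc n))"
    and k: "infinite {n. rank A (s n) = k}" "\<And>n. n \<ge> N \<Longrightarrow> rank A (s n) \<le> k"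
    and p: "infinite {n. s n = p}" "s n = p" "n \<ge> N"
  shows "\<exists>K. is_loop A p K k (\<lambda>i. s (n + i)) (\<lambda>i. l (n + i)) (\<lambda>i. d (n + i))"
proof -
  obtain i where i: "i \<ge> n" "rank A (s i) = k" using k(1) unfolding infinite_nat_iff_unbounded by blast
  obtain j where j: "j \<ge> Suc i" "s j = p" using p(1) unfolding infinite_nat_iff_unbounded by blast
  have "is_loop A p (j - n) k (\<lambda>i. s (n + i)) (\<lambda>i. l (n + i)) (\<lambda>i. d (n + i))"
    unfolding is_loop_def
  proof (intro conjI)
    show "\<exists>c<j - n. rank A (s (n + c)) = k" using i j(1) by (intro exI[of _ "i - n"]) auto
    show "\<forall>i<j - n. edge A (s (n + i)) (l (n + i)) (d (n + i)) (s (n + Suc i))"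
      using edge by simp
  qed (use i j p k(2) in auto)
  then show ?thesis by blast
qed

lemma is_loop_rank_le: "is_loop A p K m qs ls ds \<Longrightarrow> rank A p \<le> m"
  unfolding is_loop_def by blast

text \<open>On a path that is not alive from some point on, the parity condition amounts to visiting
good states infinitely often.\<close>

definition good :: "('q, 'a) dpta \<Rightarrow> 'q \<Rightarrow> bool" where
  "good A p \<longleftrightarrow> (\<forall>m. has_loop A p m \<longrightarrow> even m)"

text \<open>A bounded form of "every path from x meets a good state"; for fixed n it inspects
  finitely many nodes.\<close>

definition hit :: "('q, 'a) dpta \<Rightarrow> (bool list \<Rightarrow> 'q) \<Rightarrow> bool list \<Rightarrow> nat \<Rightarrow> bool" where
  "hit A \<rho> x n \<longleftrightarrow> (\<forall>z. length z = n \<longrightarrow> (\<exists>i\<le>n. good A (\<rho> (x @ take i z))))"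

text \<open>Alive nodes only have to be productive here; their parity condition is treated through
  \<open>start\<close> and \<open>follow\<close>.\<close>

definition settled :: "('q, 'a) dpta \<Rightarrow> (bool list \<Rightarrow> 'q) \<Rightarrow> bool list \<Rightarrow> nat \<Rightarrow> bool" where
  "settled A \<rho> x n \<longleftrightarrow> productive A (\<rho> x) \<and> (alive A (\<rho> x) \<or> hit A \<rho> x n)"

text \<open>Every alive branch eventually coincides with \<open>follow A \<rho> x\<close> for the
last start node \<open>x\<close> on it: \<open>follow\<close> turns left whenever the left child is
alive, and the right children it thereby skips are start nodes.\<close>

definition start :: "('q, 'a) dpta \<Rightarrow> (bool list \<Rightarrow> 'q) \<Rightarrow> bool list \<Rightarrow> bool" where
  "start A \<rho> x \<longleftrightarrow> alive A (\<rho> x) \<and> (x = [] \<or> (\<exists>y. x = y @ [True] \<and> alive A (\<rho> (y @ [False]))))"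

primrec follow :: "('q, 'a) dpta \<Rightarrow> (bool list \<Rightarrow> 'q) \<Rightarrow> bool list \<Rightarrow> nat \<Rightarrow> bool list" where
  "follow A \<rho> x 0 = x"
| "follow A \<rho> x (Suc k) = follow A \<rho> x k @ [\<not> alive A (\<rho> (follow A \<rho> x k @ [False]))]"

lemma hit_mono:
  assumes "hit A \<rho> x n" "n \<le> m" shows "hit A \<rho> x m"
  unfolding hit_def
proof (intro allI impI)
  fix z :: "bool list" assume "length z = m"
  then have "length (take n z) = n" using assms(2) by simp
  then obtain i where i: "i \<le> n" "good A (\<rho> (x @ take i (take n z)))"
    using assms(1) unfolding hit_def by blast
  then have "good A (\<rho> (x @ take i z))" by (simp add: min_absorb1)
  then show "\<exists>i\<le>m. good A (\<rho> (x @ take i z))" using i(1) assms(2) by (meson le_trans)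
qed

lemma follow_path: "\<exists>\<pi>. \<forall>k. pfx \<pi> (length x + k) = follow A \<rho> x k"
proof -
  define \<delta> where "\<delta> k = (\<not> alive A (\<rho> (follow A \<rho> x k @ [False])))" for k
  have "follow A \<rho> x k = x @ pfx \<delta> k" for k
    by (induction k) (simp_all add: pfx_Suc \<delta>_def)
  then show ?thesis using pfx_through[of x \<delta>] by simp
qed

text \<open>Let k be the largest recurring rank. If k is even, an odd rank above k is seen finitely
  often and one below k is beaten by k; if \<open>k = 2 * j + 1\<close>, pair j fails.\<close>

lemma parity_ok_iff_Streett:
  assumes "finite Q" "\<And>n. s n \<in> Q" "\<And>q. q \<in> Q \<Longrightarrow> rk q \<le> K"
  shows "parity_ok rk s \<longleftrightarrow>
    (\<forall>j\<le>K. finite {n. rk (s n) = 2 * j + 1} \<or> infinite {n. rk (s n) > 2 * j + 1})"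
proof -
  obtain k N where k: "infinite {n. rk (s n) = k}" "\<And>n. n \<ge> N \<Longrightarrow> rk (s n) \<le> k"
    by (rule limsup_rank_exists[where rk = rk and s = s, OF assms(1,2)]) blast
  have par: "parity_ok rk s \<longleftrightarrow> even k" by (rule parity_ok_iff_even[where s = s, OF k])
  have gt: "finite {n. rk (s n) = j}" "finite {n. rk (s n) > j'}" if "j > k" "j' \<ge> k" for j j'
    unfolding finite_nat_iff_eventually_not using k(2) that
    by (intro exI[of _ N] allI impI, fastforce)+
  show ?thesis
  proof (cases "even k")
    case True
    have "finite {n. rk (s n) = 2 * j + 1} \<or> infinite {n. rk (s n) > 2 * j + 1}" for j
    proof (cases "2 * j + 1 > k")
      case False
      then have "2 * j + 1 < k" using True by (metis even_add even_mult_iff even_numeral linorder_neqE_nat odd_one)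
      then have "{n. rk (s n) = k} \<subseteq> {n. rk (s n) > 2 * j + 1}" by auto
      then show ?thesis using k(1) finite_subset by blast
    qed (use gt(1) in blast)
    then show ?thesis using par True by simp
  next
    case False
    then obtain j where j: "k = 2 * j + 1" by (elim oddE)
    have "\<exists>n. rk (s n) = k" using k(1) by (metis (mono_tags, lifting) Collect_empty_eq finite.emptyI)
    then have "j \<le> K" using assms(2,3) j by (metis add_leD1 le_trans mult_2)
    moreover have "finite {n. rk (s n) > 2 * j + 1}" using gt(2)[of "Suc k" k] j by simp
    ultimately show ?thesis using par False k(1) j by blast
  qed
qed

section \<open>The run of a fixed automaton on a fixed tree\<close>

context
  fixes A :: "('q, 'a) dpta" and t :: "bool list \<Rightarrow> 'a"
  assumes wf: "wf_dpta A" and t: "t \<in> trees (alph A)"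
begin

lemma run_snoc: "run A t (x @ [d]) = child d (trans A (run A t x) (t x))"
  by (simp add: run_def run_from_snoc)

lemma run_states: "run A t x \<in> states A"
proof (induction x rule: rev_induct)
  case Nil
  then show ?case using wf by (simp add: run_def wf_dpta_def)
next
  case (snoc d x)
  then show ?case using wf t unfolding run_snoc by (simp add: wf_dpta_def trees_def child_def)
qed

lemma run_limsup:
  obtains k N where "infinite {n. rank A (run A t (pfx \<pi> n)) = k}"
    and "\<And>n. n \<ge> N \<Longrightarrow> rank A (run A t (pfx \<pi> n)) \<le> k"
  using limsup_rank_exists[of "states A" "\<lambda>n. run A t (pfx \<pi> n)" "rank A"] run_states wf
  unfolding wf_dpta_def by blast

lemma accepted_productive:
  assumes "accepts A (init A) t" shows "productive A (run A t x)"
  using accepts_run_from[OF assms, of x] subtree_trees[OF t, of x]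
  unfolding productive_def run_def by blast

context
  assumes prod: "\<And>x. productive A (run A t x)"
begin

text \<open>With all nodes productive, every step of the run is an \<open>edge\<close>, so loops
  found on the run count for \<open>good\<close>, \<open>flower\<close> and
  \<open>replicated_flower\<close>.\<close>

lemma run_edge: "edge A (run A t x) (t x) d (run A t (x @ [d]))"
  unfolding edge_def using t prod[of "x @ [_]"] by (simp add: run_snoc trees_def)

lemma run_reach: "reach A (run A t x) (run A t (x @ y))"
proof (induction y rule: rev_induct)
  case (snoc d y)
  then show ?case using run_edge[of "x @ y" d] unfolding reach_def
    by (metis (no_types, lifting) append.assoc rtranclp.rtrancl_into_rtrancl)
qed (simp add: reach_def)

lemma alive_prefix: "alive A (run A t (x @ y)) \<Longrightarrow> alive A (run A t x)"
  using run_reach[of x y] unfolding alive_def reach_def by (meson rtranclp_trans)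

lemma alive_take: "alive A (run A t z) \<Longrightarrow> alive A (run A t (take n z))"
  using alive_prefix[of "take n z" "drop n z"] by simp

lemma path_edge: "edge A (run A t (pfx \<pi> n)) (t (pfx \<pi> n)) (\<pi> n) (run A t (pfx \<pi> (Suc n)))"
  unfolding pfx_Suc by (rule run_edge)

text \<open>Some good state recurs; the run cuts out a loop at it whose maximal rank is the largest
  recurring rank, which is therefore even.\<close>

lemma good_parity_ok:
  assumes "infinite {n. good A (run A t (pfx \<pi> n))}"
  shows "parity_ok (rank A) (\<lambda>n. run A t (pfx \<pi> n))"
proof -
  let ?s = "\<lambda>n. run A t (pfx \<pi> n)"
  obtain k N where k: "infinite {n. rank A (?s n) = k}" "\<And>n. n \<ge> N \<Longrightarrow> rank A (?s n) \<le> k"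
    using run_limsup by blast
  obtain q where q: "infinite {n. good A (?s n) \<and> ?s n = q}"
    using infinite_pigeonhole[OF assms, of "states A" ?s] run_states wf unfolding wf_dpta_def by blast
  then obtain n where n: "n \<ge> N" "?s n = q" "good A q" unfolding infinite_nat_iff_unbounded by blast
  have "infinite {n. ?s n = q}" using q unfolding infinite_nat_iff_unbounded by blast
  then have "has_loop A q k" unfolding has_loop_def
    using sequence_loop[where s = ?s, OF path_edge k _ n(2,1)] by blast
  then have "even k" using n(3) by (simp add: good_def)
  then show ?thesis using parity_ok_iff_even[where s = ?s, OF k] by simp
qed

text \<open>A recurring state q of the largest recurring rank k, even by acceptance, is good: an odd
  loop at q would have rank above k and make q a flower, hence alive.\<close>

lemma accepted_dead_path_good:
  assumes acc: "parity_ok (rank A) (\<lambda>n. run A t (pfx \<pi> n))" and dead: "\<not> alive A (run A t (pfx \<pi> n0))"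
  shows "infinite {n. good A (run A t (pfx \<pi> n))}"
proof -
  let ?s = "\<lambda>n. run A t (pfx \<pi> n)"
  obtain k N where k: "infinite {n. rank A (?s n) = k}" "\<And>n. n \<ge> N \<Longrightarrow> rank A (?s n) \<le> k"
    using run_limsup by blast
  then have ev: "even k" using acc parity_ok_iff_even[where s = ?s, OF k] by simp
  obtain q where "infinite {n. rank A (?s n) = k \<and> ?s n = q}"
    using infinite_pigeonhole[OF k(1), of "states A" ?s] run_states wf unfolding wf_dpta_def by blast
  then have q: "infinite {n. ?s n = q}" and rq: "rank A q = k"
    unfolding infinite_nat_iff_unbounded by blast+
  obtain n where n: "n \<ge> max N n0" "?s n = q" using q unfolding infinite_nat_iff_unbounded by blast
  have nN: "n \<ge> N" using n(1) by simp
  have "has_loop A q k" unfolding has_loop_def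
    using sequence_loop[where s = ?s, OF path_edge k q n(2) nN] by blast
  have "even m" if "has_loop A q m" for m
  proof (rule ccontr)
    assume "odd m"
    then have "k < m" using that is_loop_rank_le rq ev unfolding has_loop_def by (metis le_neq_implies_less)
    then have "flower A q" unfolding flower_def using ev \<open>odd m\<close> that \<open>has_loop A q k\<close> by blast
    then have "alive A (?s n)" unfolding alive_def reach_def n(2) by blast
    then show False using dead alive_take[of "pfx \<pi> n" n0] n(1) by simp
  qed
  then have "{n. ?s n = q} \<subseteq> {n. good A (?s n)}" by (auto simp: good_def)
  then show ?thesis using q finite_subset by blast
qed

text \<open>If no level bounded the first good state, Koenig's lemma applied to the nodes not yet
  past a good state would give a path below x without good states.\<close>

lemma dead_hit:
  assumes "\<And>\<pi> n. pfx \<pi> n = x \<Longrightarrow> infinite {n. good A (run A t (pfx \<pi> n))}"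
  shows "\<exists>n. hit A (run A t) x n"
proof (rule ccontr)
  assume no: "\<not> ?thesis"
  define X where "X = {z. \<forall>i\<le>length z. \<not> good A (run A t (x @ take i z))}"
  have "n \<in> length ` X" for n
  proof -
    obtain z where "length z = n" "\<forall>i\<le>n. \<not> good A (run A t (x @ take i z))"
      using no unfolding hit_def by blast
    then show ?thesis by (auto simp: X_def)
  qed
  then have "length ` X = UNIV" by blast
  then have "infinite X" using finite_imageI infinite_UNIV_nat by metis
  then obtain \<pi> where \<pi>: "\<And>n. infinite {z \<in> X. take n z = pfx \<pi> n}" using konig by blast
  have ng: "\<not> good A (run A t (x @ pfx \<pi> n))" for n
  proof -
    obtain z where "z \<in> X" "take n z = pfx \<pi> n"
      using \<pi>[of n] by (metis (mono_tags, lifting) Collect_empty_eq finite.emptyI)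
    moreover from this(2) have "n \<le> length z" by (metis length_pfx length_take min.cobounded1)
    ultimately show ?thesis unfolding X_def by (metis (mono_tags, lifting) mem_Collect_eq)
  qed
  obtain \<pi>' where \<pi>': "\<And>n. pfx \<pi>' (length x + n) = x @ pfx \<pi> n" using pfx_through by blast
  then have "infinite {n. good A (run A t (pfx \<pi>' n))}" using assms[of \<pi>' "length x"] \<pi>'[of 0] by simp
  then obtain n where "n \<ge> length x" "good A (run A t (pfx \<pi>' n))"
    unfolding infinite_nat_iff_unbounded by blast
  then show False using ng \<pi>' by (metis le_add_diff_inverse)
qed

text \<open>Koenig's lemma turns infinitely many start nodes into a path with infinitely many alive
  siblings. A state recurring at such branchings lies on an accepting loop, which yields a
  replicated flower.\<close>

lemma finite_starts:
  assumes acc: "accepts A (init A) t"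
    and no_rep: "\<not> replicated_flower A"
  shows "finite {x. start A (run A t) x}"
proof (rule ccontr)
  assume "infinite {x. start A (run A t) x}"
  then obtain \<pi> where \<pi>: "\<And>n. infinite {z \<in> {x. start A (run A t) x}. take n z = pfx \<pi> n}"
    using konig by blast
  let ?s = "\<lambda>n. run A t (pfx \<pi> n)"
  have "\<exists>n'\<ge>n. alive A (run A t (pfx \<pi> n' @ [\<not> \<pi> n']))" for n
  proof -
    have "\<not> {z \<in> {x. start A (run A t) x}. take n z = pfx \<pi> n} \<subseteq> {pfx \<pi> n}"
      using \<pi>[of n] finite_subset by blast
    then obtain z where z: "start A (run A t) z" "take n z = pfx \<pi> n" "z \<noteq> pfx \<pi> n" by blast
    from z(2) have "n \<le> length z" by (metis length_pfx length_take min.cobounded1)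
    with z have len: "n < length z" by (metis le_neq_implies_less take_all_iff order_refl)
    have az: "alive A (run A t z)" using z(1) by (simp add: start_def)
    show ?thesis
    \<comment> \<open>If z lies on \<pi>, its last step is a right turn with an alive left sibling.
      Otherwise z leaves \<pi> at some i, and the sibling there is alive as a prefix of z.\<close>
    proof (cases "\<forall>i<length z. z ! i = \<pi> i")
      case True
      obtain y where y: "z = y @ [True]" "alive A (run A t (y @ [False]))"
        using z(1) len unfolding start_def by auto
      have "y = pfx \<pi> (length y)"
      proof (rule nth_equalityI)
        fix i assume i: "i < length y"
        then have "z ! i = \<pi> i" using True y(1) by simp
        then show "y ! i = pfx \<pi> (length y) ! i" using i y(1) by (simp add: pfx_def nth_append)
      qed simp
      moreover have "\<pi> (length y)" using True y(1) by (metis length_append_singleton lessI nth_append_length)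
      ultimately show ?thesis using y(2) len y(1) by (intro exI[of _ "length y"]) auto
    next
      case False
      then have ex: "\<exists>i. i < length z \<and> z ! i \<noteq> \<pi> i" by blast
      define i where "i = (LEAST i. i < length z \<and> z ! i \<noteq> \<pi> i)"
      have i: "i < length z" "z ! i \<noteq> \<pi> i" using LeastI_ex[OF ex] by (auto simp: i_def)
      have "\<And>j. j < i \<Longrightarrow> z ! j = \<pi> j" using not_less_Least[of _ "\<lambda>i. i < length z \<and> z ! i \<noteq> \<pi> i"] i(1)
        unfolding i_def[symmetric] by (meson less_trans)
      then have "take i z = pfx \<pi> i" using i(1) by (intro nth_equalityI) (auto simp: pfx_def)
      then have "take (Suc i) z = pfx \<pi> i @ [\<not> \<pi> i]" using i by (simp add: take_Suc_conv_app_nth)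
      moreover have "n \<le> i"
      proof (rule ccontr)
        assume "\<not> n \<le> i"
        then have "take n z ! i = z ! i" "pfx \<pi> n ! i = \<pi> i" by (simp_all add: pfx_def)
        then show False using z(2) i(2) by simp
      qed
      ultimately show ?thesis using alive_take[OF az, of "Suc i"] by auto
    qed
  qed
  then have inf: "infinite {n. alive A (run A t (pfx \<pi> n @ [\<not> \<pi> n]))}"
    unfolding infinite_nat_iff_unbounded by blast
  obtain k N where k: "infinite {n. rank A (?s n) = k}" "\<And>n. n \<ge> N \<Longrightarrow> rank A (?s n) \<le> k"
    using run_limsup by blast
  have ev: "even k" using acc parity_ok_iff_even[where s = ?s, OF k] by (simp add: accepts_def run_def)
  obtain p where p: "infinite {n. alive A (run A t (pfx \<pi> n @ [\<not> \<pi> n])) \<and> ?s n = p}"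
    using infinite_pigeonhole[OF inf, of "states A" ?s] run_states wf unfolding wf_dpta_def by blast
  then obtain n where n: "n \<ge> N" "?s n = p" and al: "alive A (run A t (pfx \<pi> n @ [\<not> \<pi> n]))"
    unfolding infinite_nat_iff_unbounded by blast
  have "infinite {n. ?s n = p}" using p unfolding infinite_nat_iff_unbounded by blast
  then obtain K where lp: "is_loop A p K k (\<lambda>i. ?s (n + i)) (\<lambda>i. t (pfx \<pi> (n + i))) (\<lambda>i. \<pi> (n + i))"
    using sequence_loop[where s = ?s, OF path_edge k _ n(2,1)] by blast
  have "reach A (init A) p" using run_reach[of "[]" "pfx \<pi> n"] n(2) by (simp add: run_def)
  moreover have "alive A (child (\<not> \<pi> (n + 0)) (trans A p (t (pfx \<pi> (n + 0)))))"
    using al n(2) by (simp add: run_snoc)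
  ultimately show False using no_rep lp ev unfolding replicated_flower_def by blast
qed

text \<open>After the last start node on the path, a right turn past an alive left child would
  create a later start node, so every turn is the one that \<open>follow\<close> takes.\<close>

lemma alive_path_follow:
  assumes fin: "finite {x. start A (run A t) x}" and al: "\<And>n. alive A (run A t (pfx \<pi> n))"
  shows "\<exists>x m. start A (run A t) x \<and> (\<forall>k. pfx \<pi> (m + k) = follow A (run A t) x k)"
proof -
  define M where "M = {n. start A (run A t) (pfx \<pi> n)}"
  have "pfx \<pi> ` M \<subseteq> {x. start A (run A t) x}" by (auto simp: M_def)
  moreover have "inj_on (pfx \<pi>) M" by (rule inj_onI) (metis length_pfx)
  ultimately have finM: "finite M" using fin by (meson finite_subset finite_imageD)
  have "0 \<in> M" using al[of 0] by (simp add: M_def start_def)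
  then have m: "Max M \<in> M" using finM by (metis Max_in empty_iff)
  have "pfx \<pi> (Max M + k) = follow A (run A t) (pfx \<pi> (Max M)) k" for k
  proof (induction k)
    case (Suc k)
    let ?n = "Max M + k"
    have "\<pi> ?n \<longleftrightarrow> \<not> alive A (run A t (pfx \<pi> ?n @ [False]))"
    proof
      assume d: "\<pi> ?n"
      show "\<not> alive A (run A t (pfx \<pi> ?n @ [False]))"
      proof
        assume "alive A (run A t (pfx \<pi> ?n @ [False]))"
        then have "Suc ?n \<in> M" using al[of "Suc ?n"] d by (simp add: M_def start_def pfx_Suc)
        then show False using Max_ge[OF finM] by fastforce
      qed
    next
      show "\<not> alive A (run A t (pfx \<pi> ?n @ [False])) \<Longrightarrow> \<pi> ?n"
        using al[of "Suc ?n"] by (cases "\<pi> ?n") (simp_all add: pfx_Suc)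
    qed
    then show ?case using Suc by (simp add: pfx_Suc)
  qed simp
  then show ?thesis using m unfolding M_def by blast
qed

end

lemma accepts_run_iff: "accepts A (init A) t \<longleftrightarrow> (\<forall>\<pi>. parity_ok (rank A) (\<lambda>n. run A t (pfx \<pi> n)))"
  by (simp add: accepts_def run_def)

text \<open>Conversely, \<open>settled\<close> supplies productivity. A path that stays alive ends
  in a \<open>follow\<close> branch; on any other path all late nodes are dead, and their
  \<open>hit\<close> bounds give good states again and again.\<close>

lemma accepts_characterization:
  assumes no_rep: "\<not> replicated_flower A"
  shows "accepts A (init A) t \<longleftrightarrow>
    (\<forall>x. \<exists>n. settled A (run A t) x n) \<and> finite {x. start A (run A t) x} \<and>
    (\<forall>x. start A (run A t) x \<longrightarrow> parity_ok (rank A) (\<lambda>k. run A t (follow A (run A t) x k)))"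
proof (intro iffI conjI)
  assume acc: "accepts A (init A) t"
  note prod = accepted_productive[OF acc]
  have par: "parity_ok (rank A) (\<lambda>n. run A t (pfx \<pi> n))" for \<pi> using acc accepts_run_iff by blast
  show "finite {x. start A (run A t) x}" by (rule finite_starts[OF prod acc no_rep])
  show "\<forall>x. \<exists>n. settled A (run A t) x n"
  proof
    fix x
    show "\<exists>n. settled A (run A t) x n"
    proof (cases "alive A (run A t x)")
      case False
      have "\<exists>n. hit A (run A t) x n"
        by (rule dead_hit[OF prod]) (use accepted_dead_path_good[OF prod par] False in blast)
      then show ?thesis using prod by (auto simp: settled_def)
    qed (use prod in \<open>simp add: settled_def\<close>)
  qed
  show "\<forall>x. start A (run A t) x \<longrightarrow> parity_ok (rank A) (\<lambda>k. run A t (follow A (run A t) x k))"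
  proof (intro allI impI)
    fix x
    obtain \<pi> where "\<forall>k. pfx \<pi> (length x + k) = follow A (run A t) x k" using follow_path by blast
    then show "parity_ok (rank A) (\<lambda>k. run A t (follow A (run A t) x k))"
      using par[of \<pi>] parity_ok_shift[of "rank A" "\<lambda>n. run A t (pfx \<pi> n)" "length x"]
      by (simp add: add.commute)
  qed
next
  assume R: "(\<forall>x. \<exists>n. settled A (run A t) x n) \<and> finite {x. start A (run A t) x} \<and>
    (\<forall>x. start A (run A t) x \<longrightarrow> parity_ok (rank A) (\<lambda>k. run A t (follow A (run A t) x k)))"
  then have prod: "\<And>x. productive A (run A t x)" by (auto simp: settled_def)
  show "accepts A (init A) t"
    unfolding accepts_run_iff
  proof
    fix \<pi>
    show "parity_ok (rank A) (\<lambda>n. run A t (pfx \<pi> n))"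
    proof (cases "\<forall>n. alive A (run A t (pfx \<pi> n))")
      case True
      then obtain x m where x: "start A (run A t) x" "\<And>k. pfx \<pi> (m + k) = follow A (run A t) x k"
        using alive_path_follow[OF prod] R by blast
      then have "parity_ok (rank A) (\<lambda>k. run A t (pfx \<pi> (k + m)))"
        using R by (simp add: add.commute)
      then show ?thesis using parity_ok_shift[of "rank A" "\<lambda>n. run A t (pfx \<pi> n)" m] by simp
    next
      case False
      then obtain n0 where n0: "\<not> alive A (run A t (pfx \<pi> n0))" by blast
      show ?thesis
      proof (rule good_parity_ok[OF prod])
        show "infinite {n. good A (run A t (pfx \<pi> n))}"
          unfolding infinite_nat_iff_unbounded
        proof
          fix M
          let ?n = "max M n0"
          have "\<not> alive A (run A t (pfx \<pi> ?n))"
            using n0 alive_take[OF prod, of "pfx \<pi> ?n" n0] by auto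
          then obtain k where "hit A (run A t) (pfx \<pi> ?n) k" using R unfolding settled_def by blast
          then obtain i where i: "i \<le> k" "good A (run A t (pfx \<pi> ?n @ take i (pfx (\<lambda>i. \<pi> (?n + i)) k)))"
            unfolding hit_def by (metis length_pfx)
          then have "good A (run A t (pfx \<pi> (?n + i)))" by (simp add: pfx_add)
          then show "\<exists>n\<ge>M. good A (run A t (pfx \<pi> n))" by (intro exI[of _ "?n + i"]) simp
        qed
      qed
    qed
  qed
qed

end

text \<open>The event at \<open>k\<close> is that the number of initial requirements \<open>R 0, R 1, \<dots>\<close>
met by time \<open>k\<close> (counted up to \<open>k\<close>) grows in the next step.\<close>

lemma all_ex_iff_infinite:
  fixes R :: "nat \<Rightarrow> nat \<Rightarrow> bool"
  assumes mono: "\<And>i n m. R i n \<Longrightarrow> n \<le> m \<Longrightarrow> R i m"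
  shows "(\<forall>i. \<exists>n. R i n) \<longleftrightarrow>
    infinite {k. \<exists>i\<le>Suc k. (\<forall>j<i. R j (Suc k)) \<and> \<not> (i \<le> k \<and> (\<forall>j<i. R j k))}"
proof -
  \<comment> \<open>\<open>C k\<close> is an initial segment that grows with k, and the cap
    \<open>i \<le> k\<close> keeps it finite. If requirement i is never met, \<open>C k\<close>
    stays within \<open>{..i}\<close>, and each element enters at most once.\<close>
  define C where "C k = {i. i \<le> k \<and> (\<forall>j<i. R j k)}" for k
  define E where "E = {k. \<exists>i. i \<in> C (Suc k) \<and> i \<notin> C k}"
  have C_mono: "C k \<subseteq> C l" if "k \<le> l" for k l
    using that mono unfolding C_def by fastforce
  have "(\<forall>i. \<exists>n. R i n) \<longleftrightarrow> infinite E"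
  proof
    assume all: "\<forall>i. \<exists>n. R i n"
    have ex: "\<exists>n. i \<in> C n" for i
    proof (induction i)
      case 0
      then show ?case by (auto simp: C_def)
    next
      case (Suc i)
      then obtain n m where n: "i \<in> C n" and m: "R i m" using all by blast
      have "i \<in> C (max (Suc n) m)" using C_mono[of n "max (Suc n) m"] n by (meson Suc_leD max.cobounded1 subsetD)
      moreover have "R i (max (Suc n) m)" using mono[OF m] by simp
      moreover have "i < max (Suc n) m" using n by (auto simp: C_def)
      ultimately have "Suc i \<in> C (max (Suc n) m)" by (auto simp: C_def less_Suc_eq)
      then show ?case by blast
    qed
    show "infinite E"
    proof
      assume "finite E"
      then have "finite {k. k \<in> E}" by simp
      then obtain N where N: "\<And>k. k \<ge> N \<Longrightarrow> k \<notin> E" unfolding finite_nat_iff_eventually_not by blast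
      have "C k \<subseteq> C N" if "k \<ge> N" for k
        using that by (induction k rule: dec_induct) (use N in \<open>auto simp: E_def\<close>)
      then have "C k \<subseteq> C N" for k using C_mono[of k N] nat_le_linear by blast
      then have "Suc N \<in> C N" using ex[of "Suc N"] by blast
      then show False by (simp add: C_def)
    qed
  next
    assume inf: "infinite E"
    show "\<forall>i. \<exists>n. R i n"
    proof (rule ccontr)
      assume "\<not> ?thesis"
      then obtain i where "\<And>n. \<not> R i n" by blast
      then have sub: "C k \<subseteq> {..i}" for k unfolding C_def by (auto simp: not_less[symmetric])
      have "\<forall>k\<in>E. \<exists>i. i \<in> C (Suc k) \<and> i \<notin> C k" by (simp add: E_def)
      from bchoice[OF this] obtain g where g: "\<forall>k\<in>E. g k \<in> C (Suc k) \<and> g k \<notin> C k" ..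
      have "g k \<in> {..i}" if "k \<in> E" for k using g sub that by blast
      moreover have "infinite {k. k \<in> E}" using inf by simp
      ultimately obtain q where q: "infinite {k. k \<in> E \<and> g k = q}"
        using infinite_pigeonhole[of "\<lambda>k. k \<in> E" "{..i}" g] by blast
      then obtain k where k: "k \<in> E" "g k = q" unfolding infinite_nat_iff_unbounded by blast
      obtain l where l: "l \<ge> Suc k" "l \<in> E" "g l = q" using q unfolding infinite_nat_iff_unbounded by blast
      have "q \<in> C (Suc k)" "q \<notin> C l" using g k l(2,3) by auto
      then show False using C_mono[OF l(1)] by (meson subsetD)
    qed
  qed
  moreover have "E = {k. \<exists>i\<le>Suc k. (\<forall>j<i. R j (Suc k)) \<and> \<not> (i \<le> k \<and> (\<forall>j<i. R j k))}"
    by (auto simp: E_def C_def)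
  ultimately show ?thesis by simp
qed

section \<open>Finite dependence of the reduction on the run\<close>

lemma local_all_less:
  assumes "\<And>j. local (f j)" shows "local (\<lambda>t. \<forall>j<i::nat. f j t)"
proof (induction i)
  case (Suc i)
  have "(\<forall>j<Suc i. f j t) \<longleftrightarrow> (\<forall>j<i. f j t) \<and> f i t" for t using less_Suc_eq by auto
  then show ?case using local_comp2[OF Suc assms[of i], of "(\<and>)"] by simp
qed (simp add: local_def)

lemma local_settled: "local (\<lambda>\<rho>. settled (A :: ('q, 'a) dpta) \<rho> x n)"
  unfolding local_def
proof (intro exI allI impI)
  fix \<rho> \<rho>' :: "bool list \<Rightarrow> 'q" assume ag: "agree (length x + n) \<rho> \<rho>'"
  then have "\<rho> x = \<rho>' x" "\<And>i z. i \<le> n \<Longrightarrow> \<rho> (x @ take i z) = \<rho>' (x @ take i z)"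
    by (auto simp: agree_def)
  then show "settled A \<rho> x n = settled A \<rho>' x n"
    unfolding settled_def hit_def by (simp cong: conj_cong)
qed

lemma local_start: "local (\<lambda>\<rho>. start (A :: ('q, 'a) dpta) \<rho> x)"
  unfolding local_def
proof (intro exI allI impI)
  fix \<rho> \<rho>' :: "bool list \<Rightarrow> 'q" assume "agree (length x) \<rho> \<rho>'"
  then have "\<rho> x = \<rho>' x" "\<And>y. x = y @ [True] \<Longrightarrow> \<rho> (y @ [False]) = \<rho>' (y @ [False])"
    by (auto simp: agree_def)
  then show "start A \<rho> x = start A \<rho>' x" unfolding start_def by metis
qed

text \<open>The first k turns inspect only nodes of depth at most
  \<open>length x + k\<close>.\<close>

lemma local_follow: "local (\<lambda>\<rho>. F (\<rho> (follow A \<rho> x k)))"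
proof -
  have len: "length (follow A \<rho> x k) = length x + k" for \<rho> k by (induction k) simp_all
  have "follow A \<rho> x k = follow A \<rho>' x k" if "agree (length x + k) \<rho> \<rho>'" for \<rho> \<rho>'
    using that
  proof (induction k)
    case (Suc k)
    then have eq: "follow A \<rho> x k = follow A \<rho>' x k" by (simp add: agree_def)
    have "\<rho> (follow A \<rho>' x k @ [False]) = \<rho>' (follow A \<rho>' x k @ [False])"
      using Suc.prems len[of \<rho>' k] by (simp add: agree_def)
    then show ?case using eq by simp
  qed simp
  note follow_eq = this
  have "F (\<rho> (follow A \<rho> x k)) = F (\<rho>' (follow A \<rho>' x k))" if "agree (length x + k) \<rho> \<rho>'" for \<rho> \<rho>'
    using that len[of \<rho>' k] unfolding follow_eq[OF that] by (simp add: agree_def)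
  then show ?thesis unfolding local_def by blast
qed

lemma local_htree:
  assumes "\<And>m. local (\<lambda>\<rho>. c \<rho> m)" "\<And>m k. local (\<lambda>\<rho>. \<phi> \<rho> m k)" "\<And>m k. local (\<lambda>\<rho>. \<psi> \<rho> m k)"
  shows "local (\<lambda>\<rho>. htree (c \<rho>) (\<phi> \<rho>) (\<psi> \<rho>) x)"
proof (cases "dropWhile Not x")
  case Nil
  then show ?thesis using local_comp[OF assms(1), of "\<lambda>e. if e then a1 else a0"]
    by (simp add: htree_def del: dropWhile_eq_Nil_conv)
next
  case (Cons e y)
  then show ?thesis
    using local_comp2[OF assms(3,2), of "\<lambda>e f. if e then a2 else if f then a1 else a0"]
    by (simp add: htree_def Let_def)
qed

text \<open>Test 0 is the condition on the non-alive part; test \<open>Suc e\<close> is the Streett condition for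
rank \<open>2 * j + 1\<close> on the branch started at \<open>x\<close>, where \<open>e\<close> encodes
\<open>(x, j)\<close>.\<close>

definition spawns :: "('q, 'a) dpta \<Rightarrow> (bool list \<Rightarrow> 'q) \<Rightarrow> nat \<Rightarrow> bool" where
  "spawns A \<rho> m = (case m of 0 \<Rightarrow> True
     | Suc e \<Rightarrow> \<exists>x. \<exists>j\<le>Max (rank A ` states A). e = to_nat (x :: bool list, j) \<and> start A \<rho> x)"

definition bad_event :: "('q, 'a) dpta \<Rightarrow> (bool list \<Rightarrow> 'q) \<Rightarrow> nat \<Rightarrow> nat \<Rightarrow> bool" where
  "bad_event A \<rho> m k = (case m of 0 \<Rightarrow> True
     | Suc e \<Rightarrow> case from_nat e of (x :: bool list, j :: nat) \<Rightarrow> rank A (\<rho> (follow A \<rho> x k)) = 2 * j + 1)"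

definition good_event :: "('q, 'a) dpta \<Rightarrow> (bool list \<Rightarrow> 'q) \<Rightarrow> nat \<Rightarrow> nat \<Rightarrow> bool" where
  "good_event A \<rho> m k = (case m of
       0 \<Rightarrow> \<exists>i\<le>Suc k. (\<forall>j<i. settled A \<rho> (from_nat j) (Suc k)) \<and>
              \<not> (i \<le> k \<and> (\<forall>j<i. settled A \<rho> (from_nat j) k))
     | Suc e \<Rightarrow> case from_nat e of (x :: bool list, j :: nat) \<Rightarrow> rank A (\<rho> (follow A \<rho> x k)) > 2 * j + 1)"

text \<open>Decoding e leaves a single candidate (x, j) for the existential quantifiers, so only one
  start condition is consulted.\<close>

lemma local_spawns: "local (\<lambda>\<rho>. spawns A \<rho> m)"
proof (cases m)
  case (Suc e)
  obtain x :: "bool list" and j :: nat where e: "from_nat e = (x, j)" by (cases "from_nat e :: bool list \<times> nat")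
  then have "e = to_nat (y, i) \<Longrightarrow> y = x \<and> i = j" for y i by simp
  then have "spawns A \<rho> m \<longleftrightarrow> (j \<le> Max (rank A ` states A) \<and> e = to_nat (x, j)) \<and> start A \<rho> x" for \<rho>
    unfolding spawns_def Suc by auto
  then show ?thesis using local_comp[OF local_start, of "\<lambda>e'. (j \<le> Max (rank A ` states A) \<and> e = to_nat (x, j)) \<and> e'" A x] by simp
qed (simp add: spawns_def local_def)

lemma local_bad_event: "local (\<lambda>\<rho>. bad_event A \<rho> m k)"
proof (cases m)
  case (Suc e)
  obtain x :: "bool list" and j :: nat where "from_nat e = (x, j)" by (cases "from_nat e :: bool list \<times> nat")
  then show ?thesis using local_follow[of "\<lambda>q. rank A q = 2 * j + 1" A x k] by (simp add: bad_event_def Suc)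
qed (simp add: bad_event_def local_def)

lemma local_good_event: "local (\<lambda>\<rho>. good_event A \<rho> m k)"
proof (cases m)
  case 0
  \<comment> \<open>The bounded existential is written as a negated bounded universal to fit
    \<open>local_all_less\<close>.\<close>
  have "local (\<lambda>\<rho>. \<not> (\<forall>i<Suc (Suc k). \<not> ((\<forall>j<i. settled A \<rho> (from_nat j) (Suc k)) \<and>
      \<not> (i \<le> k \<and> (\<forall>j<i. settled A \<rho> (from_nat j) k)))))"
    by (intro local_comp[of _ Not] local_all_less local_comp2[of _ _ "\<lambda>a b. \<not> (a \<and> \<not> (_ \<and> b))"] local_settled)
  then show ?thesis by (simp add: good_event_def 0 less_Suc_eq_le)
next
  case (Suc e)
  obtain x :: "bool list" and j :: nat where "from_nat e = (x, j)" by (cases "from_nat e :: bool list \<times> nat")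
  then show ?thesis using local_follow[of "\<lambda>q. rank A q > 2 * j + 1" A x k] by (simp add: good_event_def Suc)
qed

lemma accepts_iff_htree:
  assumes wf: "wf_dpta A" and t: "t \<in> trees (alph A)"
    and no_rep: "\<not> replicated_flower A"
  shows "accepts A (init A) t \<longleftrightarrow>
    accepts H P0 (htree (spawns A (run A t)) (bad_event A (run A t)) (good_event A (run A t)))"
proof -
  let ?\<rho> = "run A t" and ?K = "Max (rank A ` states A)"
  define code where "code p = Suc (to_nat p)" for p :: "bool list \<times> nat"
  have K: "q \<in> states A \<Longrightarrow> rank A q \<le> ?K" for q using wf by (simp add: wf_dpta_def)
  have fin: "finite (states A)" using wf by (simp add: wf_dpta_def)
  have "spawns A ?\<rho> m \<longleftrightarrow> m \<in> insert 0 (code ` ({x. start A ?\<rho> x} \<times> {..?K}))" for m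
    by (cases m) (auto simp: spawns_def code_def)
  then have "{m. spawns A ?\<rho> m} = insert 0 (code ` ({x. start A ?\<rho> x} \<times> {..?K}))" by blast
  moreover have "inj_on code S" for S by (simp add: inj_on_def code_def)
  \<comment> \<open>Each start node spawns finitely many tests and at least one, so finiteness of
    spawns and of start nodes coincide.\<close>
  ultimately have 1: "finite {m. spawns A ?\<rho> m} \<longleftrightarrow> finite {x. start A ?\<rho> x}"
    by (cases "{x. start A ?\<rho> x} = {}") (auto simp: finite_image_iff finite_cartesian_product_iff)
  have mono: "settled A ?\<rho> x n \<Longrightarrow> n \<le> m \<Longrightarrow> settled A ?\<rho> x m" for x n m
    using hit_mono unfolding settled_def by blast
  have "(\<forall>x. \<exists>n. settled A ?\<rho> x n) \<longleftrightarrow> (\<forall>i. \<exists>n. settled A ?\<rho> (from_nat i) n)"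
    by (metis from_nat_to_nat)
  also have "\<dots> \<longleftrightarrow> infinite {k. good_event A ?\<rho> 0 k}"
    using all_ex_iff_infinite[of "\<lambda>i. settled A ?\<rho> (from_nat i)", OF mono] by (simp add: good_event_def)
  \<comment> \<open>Test 0 has a bad event at every k, so only the alternative of infinitely many
    good events remains.\<close>
  finally have 2: "(\<forall>x. \<exists>n. settled A ?\<rho> x n) \<longleftrightarrow>
      finite {k. bad_event A ?\<rho> 0 k} \<or> infinite {k. good_event A ?\<rho> 0 k}"
    by (simp add: bad_event_def)
  define P where "P m \<longleftrightarrow> finite {k. bad_event A ?\<rho> m k} \<or> infinite {k. good_event A ?\<rho> m k}" for m
  have par: "parity_ok (rank A) (\<lambda>k. ?\<rho> (follow A ?\<rho> x k)) \<longleftrightarrow> (\<forall>j\<le>?K. P (code (x, j)))" for x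
    using parity_ok_iff_Streett[OF fin run_states[OF wf t] K]
    by (simp add: P_def bad_event_def good_event_def code_def)
  have 3: "(\<forall>x. start A ?\<rho> x \<longrightarrow> parity_ok (rank A) (\<lambda>k. ?\<rho> (follow A ?\<rho> x k))) \<longleftrightarrow>
      (\<forall>m>0. spawns A ?\<rho> m \<longrightarrow> P m)"
    unfolding par spawns_def code_def by (auto simp: gr0_conv_Suc)
  have "spawns A ?\<rho> 0" by (simp add: spawns_def)
  then have 4: "(\<forall>m. spawns A ?\<rho> m \<longrightarrow> P m) \<longleftrightarrow> P 0 \<and> (\<forall>m>0. spawns A ?\<rho> m \<longrightarrow> P m)"
    by (metis gr0I)
  show ?thesis
    unfolding accepts_characterization[OF wf t no_rep] accepts_H_htree 1 2 3 P_def[symmetric] 4 by blast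
qed

theorem theorem12p4:
  shows "lang H \<in> borel_Delta (trees (alph H)) 3 \<and>
    (\<forall>A :: ('q, 'a) dpta. wf_dpta A \<longrightarrow> lang A \<in> borel_Delta (trees (alph A)) 3 \<longrightarrow>
       wadge_le (trees (alph A)) (lang A) (trees (alph H)) (lang H))"
proof (intro conjI allI impI)
  show "lang H \<in> borel_Delta (trees (alph H)) 3" by (rule lang_H_Delta3)
next
  fix A :: "('q, 'a) dpta"
  assume wf: "wf_dpta A" and Delta: "lang A \<in> borel_Delta (trees (alph A)) 3"
  then have Sig: "lang A \<in> borel_Sigma (trees (alph A)) 3" by (simp add: borel_Delta_def)
  define F where "F \<rho> = htree (spawns A \<rho>) (bad_event A \<rho>) (good_event A \<rho>)" for \<rho>
  have "tree_continuous (trees (alph A)) (\<lambda>t. F (run A t))"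
  proof (rule tree_continuousI)
    fix y
    have "local (\<lambda>\<rho>. F \<rho> y)"
      unfolding F_def by (rule local_htree[OF local_spawns local_bad_event local_good_event])
    then obtain n where n: "\<And>\<rho> \<rho>'. agree n \<rho> \<rho>' \<Longrightarrow> F \<rho> y = F \<rho>' y" unfolding local_def by blast
    \<comment> \<open>The run preserves agreement depth, so finite dependence on the run becomes
      finite dependence on the input tree.\<close>
    have "agree n (run A s) (run A t)" if "agree n s t" for s t
      unfolding agree_def run_def by (simp add: run_from_agree[OF that])
    then show "\<exists>n. \<forall>s\<in>trees (alph A). \<forall>t\<in>trees (alph A). agree n s t \<longrightarrow> F (run A s) y = F (run A t) y"
      using n by blast
  qed
  moreover have "t \<in> lang A \<longleftrightarrow> F (run A t) \<in> lang H" if "t \<in> trees (alph A)" for t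
    using accepts_iff_htree[OF wf that Sigma3_no_replicated_flower[OF Sig]] that
    by (simp add: lang_accepts F_def)
  ultimately show "wadge_le (trees (alph A)) (lang A) (trees (alph H)) (lang H)"
    unfolding wadge_le_def by (intro exI[of _ "\<lambda>t. F (run A t)"]) simp
qed

end
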